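(* Let $(X, \mathcal{F}, \mu, T)$ be an invertible ergodic probability measure-preserving system, let $k\ge2$, and let $f\in L^\infty(\mu)$. Then $f\in L^2(\mathcal{Z}_k)^\perp$ if and only if $$\lim_{N\to\infty} \frac{1}{N^{k-1}} \sum_{h \in [N]^{k-1}} \sup_{t\in\mathbb{R}} \left| \frac{1}{N} \sum_{n=1}^N e^{2\pi i n t} \left[\prod_{\eta\in V_{k-1}} c^{|\eta|} f \circ T^{h \cdot \eta} \right](T^{n} x) \right|^2 = 0$$ for $\mu$-a.e. $x\in X$.
   Context: Notation: $[M]=\{1,\dots,M\}$; $V_k=\{0,1\}^k$; for $\eta\in V_k$, $|\eta|=\sum_j\eta_j$ and $h\cdot\eta=\sum_j h_j\eta_j$; $c$ is complex conjugation, so $c^{|\eta|}g$ equals $g$ if $|\eta|$ is even and $\overline g$ if $|\eta|$ is odd. Host-Kra-Ziegler factors. For an ergodic system and $f\in L^\infty(\mu)$ put $|||f|||_2^4=\lim_H\frac1H\sum_{h=1}^H\left|\int f\cdot\overline{f\circ T^h}\,d\mu\right|^2$ and, for $k\ge3$, $|||f|||_k^{2^k}=\lim_H\frac1H\sum_{h=1}^H|||f\cdot\overline{f\circ T^h}|||_{k-1}^{2^{k-1}}$. For $k\ge1$, $\mathcal{Z}_k$ is the $k$-th Host-Kra-Ziegler factor: the invariant sub-$\sigma$-algebra characterized by $\mathbb{E}(f|\mathcal{Z}_k)=0\iff|||f|||_{k+1}=0$ for $f\in L^\infty(\mu)$. $L^2(\mathcal{Z}_k)^\perp=\{f\in L^2(\mu):\mathbb{E}(f|\mathcal{Z}_k)=0\}$.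 *)

theory Defs
  imports "HOL-Probability.Probability"
begin

locale invertible_ergodic_system = prob_space M for M :: "'a measure" +
  fixes T :: "'a \<Rightarrow> 'a"
  assumes T_measurable: "T \<in> measurable M M"
    and T_invertible: "\<exists>S \<in> measurable M M. \<forall>x \<in> space M. S (T x) = x \<and> T (S x) = x"
    and T_preserves: "distr M M T = M"
    and T_ergodic: "\<And>A. A \<in> sets M \<Longrightarrow> T -` A \<inter> space M = A \<Longrightarrow> prob A = 0 \<or> prob A = 1"

text \<open>Elements of the Lebesgue spaces are represented by functions rather than by classes modulo
  almost everywhere equality.\<close>

definition Linfty :: "'a measure \<Rightarrow> ('a \<Rightarrow> complex) set" where
  "Linfty M = {f \<in> borel_measurable M. \<exists>C. AE x in M. cmod (f x) \<le> C}"

text \<open>The library's conditional expectation is for real-valued functions; it is extended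
  to complex-valued ones by linearity.\<close>

definition complex_cond_exp :: "'a measure \<Rightarrow> 'a measure \<Rightarrow> ('a \<Rightarrow> complex) \<Rightarrow> 'a \<Rightarrow> complex" where
  "complex_cond_exp M Z f x =
     Complex (real_cond_exp M Z (\<lambda>y. Re (f y)) x) (real_cond_exp M Z (\<lambda>y. Im (f y)) x)"

definition L2_perp :: "'a measure \<Rightarrow> 'a measure \<Rightarrow> ('a \<Rightarrow> complex) set" where
  "L2_perp M Z = {f \<in> borel_measurable M. integrable M (\<lambda>x. (cmod (f x))\<^sup>2) \<and>
                    (AE x in M. complex_cond_exp M Z f x = 0)}"

text \<open>The seminorm of order \<open>k\<close> is meaningful for \<open>k \<ge> 2\<close> only; orders 0 and 1 are dummies.
  The limits exist for \<open>f \<in> Linfty M\<close> in an ergodic system.\<close>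

fun hk_seminorm :: "'a measure \<Rightarrow> ('a \<Rightarrow> 'a) \<Rightarrow> nat \<Rightarrow> ('a \<Rightarrow> complex) \<Rightarrow> real" where
  "hk_seminorm M T 0 f = 0"
| "hk_seminorm M T (Suc 0) f = 0"
| "hk_seminorm M T (Suc (Suc 0)) f =
     root 4 (lim (\<lambda>H. (1 / real H) *
       (\<Sum>h = 1..H. (cmod (LINT x|M. f x * cnj (f ((T ^^ h) x))))\<^sup>2)))"
| "hk_seminorm M T (Suc (Suc (Suc k))) f =
     root (2 ^ (k + 3)) (lim (\<lambda>H. (1 / real H) *
       (\<Sum>h = 1..H. hk_seminorm M T (Suc (Suc k)) (\<lambda>x. f x * cnj (f ((T ^^ h) x))) ^ 2 ^ (k + 2))))"

text \<open>\<open>Z\<close> is a version of the \<open>k\<close>-th Host-Kra-Ziegler factor (\<open>k \<ge> 1\<close>). The last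
  conjunct determines \<open>Z\<close> up to null sets. Invariance is required as \<open>T\<^sup>-\<^sup>1 Z \<subseteq> Z\<close>;
  equality modulo null sets then follows, since the seminorms are invariant under \<open>f \<mapsto> f \<circ> T\<close>.\<close>

definition is_HKZ_factor :: "'a measure \<Rightarrow> ('a \<Rightarrow> 'a) \<Rightarrow> nat \<Rightarrow> 'a measure \<Rightarrow> bool" where
  "is_HKZ_factor M T k Z \<longleftrightarrow>
     subalgebra M Z \<and>
     (\<forall>A \<in> sets Z. T -` A \<inter> space M \<in> sets Z) \<and>
     (\<forall>f \<in> Linfty M. (AE x in M. complex_cond_exp M Z f x = 0) \<longleftrightarrow> hk_seminorm M T (k + 1) f = 0)"

definition cube :: "nat \<Rightarrow> (nat \<Rightarrow> nat) set" where
  "cube m = {1..m} \<rightarrow>\<^sub>E {0, 1}"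

definition cube_product ::
  "('a \<Rightarrow> 'a) \<Rightarrow> nat \<Rightarrow> ('a \<Rightarrow> complex) \<Rightarrow> (nat \<Rightarrow> nat) \<Rightarrow> 'a \<Rightarrow> complex" where
  "cube_product T m f h x =
     (\<Prod>\<eta> \<in> cube m. (cnj ^^ (\<Sum>j = 1..m. \<eta> j)) (f ((T ^^ (\<Sum>j = 1..m. h j * \<eta> j)) x)))"

end

theory Submission
  imports Defs
begin

text \<open>Write \<open>S\<^sub>n(f)\<close> for the \<open>2\<^sup>n\<close>-th power of the seminorm of order \<open>n\<close>, starting from
  \<open>S\<^sub>1(f) = |\<integral>f|\<^sup>2\<close>. By induction on \<open>n\<close> the matrices \<open>S\<^sub>n(f\<^sub>i cnj f\<^sub>j)\<close> are positive
  semidefinite, so \<open>h \<mapsto> S\<^sub>n(f \<cdot> cnj f \<circ> T\<^sup>h)\<close> is a positive definite sequence. Riesz's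
  argument for the mean ergodic theorem then shows that its averages converge, and that the limit
  \<open>S\<^bsub>n+1\<^esub>(f)\<close> is at most twice every finite average.

  If the seminorm of order \<open>k + 1\<close> vanishes, van der Corput's inequality with boundedly many differences
  removes the supremum over \<open>t\<close> at the price of correlations of the cube product, whose mean square
  over the last shift is again bounded by a supremum over \<open>t\<close>, by Parseval. This lowers the cube dimension
  while replacing \<open>f\<close> by its multiplicative derivatives, until the pointwise ergodic theorem applies.

  Conversely, Parseval bounds the mean square of the Birkhoff averages of the cube products of dimension \<open>k\<close>
  by the averages of the theorem. Integrating, the simultaneous averages of
  \<open>|\<integral>\<Prod>\<^sub>\<eta> c\<^bsup>|\<eta>|\<^esup> f \<circ> T\<^bsup>h\<cdot>\<eta>\<^esup>|\<^sup>2\<close> tend to zero, and they dominate a multiple of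
  \<open>S\<^bsub>k+1\<^esub>(f)\<close>.\<close>

section \<open>Van der Corput and Parseval inequalities\<close>

text \<open>Moving the window by one place trades its first term for the term after its end; each of
  the \<open>l\<close> moves costs two terms of size at most \<open>B\<close>.\<close>

lemma norm_sum_shift_diff:
  fixes u :: "nat \<Rightarrow> 'b::real_normed_vector"
  assumes "\<And>n. norm (u n) \<le> B"
  shows "norm ((\<Sum>n<N. u (n + l)) - (\<Sum>n<N. u n)) \<le> 2 * real l * B"
proof (induction l)
  case (Suc l)
  have "(\<Sum>n<N. u (n + Suc l)) - (\<Sum>n<N. u (n + l)) = u (N + l) - u l"
    using sum_lessThan_telescope[of "\<lambda>n. u (n + l)" N] by (simp add: sum_subtractf)
  moreover have "norm (u (N + l) - u l) \<le> 2 * B"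
    using norm_triangle_ineq4[of "u (N + l)" "u l"] assms[of "N + l"] assms[of l] by linarith
  moreover have "(\<Sum>n<N. u (n + Suc l)) - (\<Sum>n<N. u n)
      = ((\<Sum>n<N. u (n + Suc l)) - (\<Sum>n<N. u (n + l))) + ((\<Sum>n<N. u (n + l)) - (\<Sum>n<N. u n))"
    by simp
  ultimately have "norm ((\<Sum>n<N. u (n + Suc l)) - (\<Sum>n<N. u n)) \<le> 2 * B + 2 * real l * B"
    using norm_triangle_mono[OF _ Suc] by metis
  then show ?case by (simp add: algebra_simps)
qed simp

lemma norm_sum_shift_diff1:
  fixes u :: "nat \<Rightarrow> 'b::real_normed_vector"
  assumes "\<And>n. norm (u n) \<le> B"
  shows "norm ((\<Sum>n=1..N. u (n + l)) - (\<Sum>n=1..N. u n)) \<le> 2 * real l * B"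
  using norm_sum_shift_diff[of "\<lambda>n. u (Suc n)" B l N] assms
  by (simp add: sum.atLeast1_atMost_eq)

text \<open>Truncated subtraction makes \<open>(l - l') + (l' - l)\<close> the distance of
  \<open>l\<close> and \<open>l'\<close>, and every distance occurs for at most \<open>2 * L\<close>
  pairs. The induction adds one row and one column of the square.\<close>

lemma sum_symmetric_difference_le:
  fixes c :: "nat \<Rightarrow> real"
  assumes "\<And>d. 0 \<le> c d"
  shows "(\<Sum>l<L. \<Sum>l'<L. c ((l - l') + (l' - l))) \<le> 2 * real L * (\<Sum>d<L. c d)"
proof (induction L)
  case (Suc L)
  have *: "(\<Sum>l<L. c (L - l)) = (\<Sum>d<L. c (Suc d))"
    by (subst sum.nat_diff_reindex[symmetric]) (intro sum.cong, auto simp: Suc_diff_Suc)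
  have "(\<Sum>l<Suc L. \<Sum>l'<Suc L. c ((l - l') + (l' - l)))
      = (\<Sum>l<L. \<Sum>l'<L. c ((l - l') + (l' - l))) + 2 * (\<Sum>l<L. c (L - l)) + c 0"
    by (simp add: sum.distrib)
  also have "\<dots> \<le> 2 * real L * (\<Sum>d<L. c d) + 2 * (\<Sum>d<Suc L. c d)"
    using Suc assms[of 0] unfolding * by (simp add: sum.lessThan_Suc_shift del: sum.lessThan_Suc)
  also have "\<dots> \<le> 2 * real (Suc L) * (\<Sum>d<Suc L. c d)"
    using assms[of L] by (simp add: algebra_simps)
  finally show ?case .
qed simp

text \<open>Average \<open>u\<close> over \<open>L\<close> translates, apply Cauchy-Schwarz in
  \<open>n\<close> and expand the square. For fixed \<open>L\<close> the error is of order
  1/N.\<close>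

lemma van_der_corput_inequality:
  fixes u :: "nat \<Rightarrow> complex"
  assumes B: "\<And>n. cmod (u n) \<le> B" and N: "N > 0" and L: "L > 0"
  shows "(cmod (\<Sum>n=1..N. u n) / N)\<^sup>2
    \<le> 4 / L * (\<Sum>d<L. cmod (\<Sum>n=1..N. u n * cnj (u (n + d))) / N) + 12 * (real L)\<^sup>2 * B\<^sup>2 / N"
proof -
  have B0: "0 \<le> B" using B[of 0] norm_ge_zero order_trans by blast
  define s where "s = (\<Sum>n=1..N. u n)"
  define y where "y n = (\<Sum>l<L. u (n + l))" for n
  define c where "c d = cmod (\<Sum>n=1..N. u n * cnj (u (n + d)))" for d
  define X where "X = cmod (\<Sum>n=1..N. y n)"
  have "(\<Sum>n=1..N. y n) = (\<Sum>l<L. \<Sum>n=1..N. u (n + l))"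
    unfolding y_def by (rule sum.swap)
  then have "of_nat L * s = (\<Sum>n=1..N. y n) - (\<Sum>l<L. (\<Sum>n=1..N. u (n + l)) - (\<Sum>n=1..N. u n))"
    by (simp add: s_def sum_subtractf)
  then have "real L * cmod s \<le> X + cmod (\<Sum>l<L. (\<Sum>n=1..N. u (n + l)) - (\<Sum>n=1..N. u n))"
    unfolding X_def by (metis norm_triangle_ineq4 norm_mult norm_of_nat)
  also have "\<dots> \<le> X + (\<Sum>l<L. 2 * real L * B)"
  proof (intro add_left_mono order_trans[OF norm_sum] sum_mono)
    fix l assume "l \<in> {..<L}"
    then have "2 * real l * B \<le> 2 * real L * B"
      using B0 by (intro mult_right_mono) auto
    then show "cmod ((\<Sum>n=1..N. u (n + l)) - (\<Sum>n=1..N. u n)) \<le> 2 * real L * B"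
      using norm_sum_shift_diff1[of u B l N] B by (simp add: order_trans)
  qed
  finally have 1: "real L * cmod s \<le> X + 2 * (real L)\<^sup>2 * B"
    by (simp add: power2_eq_square algebra_simps)
  have "(real L * cmod s)\<^sup>2 \<le> (X + 2 * (real L)\<^sup>2 * B)\<^sup>2"
    using 1 by (intro power_mono) auto
  \<comment> \<open>Splitting off the translation error in this way doubles the factor 2 of
    \<open>sum_symmetric_difference_le\<close> to the final 4.\<close>
  also have "\<dots> \<le> 2 * X\<^sup>2 + 2 * (2 * (real L)\<^sup>2 * B)\<^sup>2"
    unfolding power2_sum using sum_squares_bound[of X "2 * (real L)\<^sup>2 * B"] by linarith
  finally have 2: "(real L)\<^sup>2 * (cmod s)\<^sup>2 \<le> 2 * X\<^sup>2 + 8 * (real L)^4 * B\<^sup>2"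
    by (simp add: power_mult_distrib flip: power_mult)
  have "X \<le> (\<Sum>n=1..N. cmod (y n))" unfolding X_def by (rule norm_sum)
  then have "X\<^sup>2 \<le> (\<Sum>n=1..N. cmod (y n))\<^sup>2" by (intro power_mono) (auto simp: X_def)
  also have "\<dots> \<le> N * (\<Sum>n=1..N. (cmod (y n))\<^sup>2)"
    using sum_squared_le_sum_of_squares[of "\<lambda>n. cmod (y n)" "{1..N}"] by (simp add: mult.commute)
  finally have 3: "X\<^sup>2 \<le> N * (\<Sum>n=1..N. (cmod (y n))\<^sup>2)" .
  \<comment> \<open>Re-indexing by the smaller of \<open>l\<close> and \<open>l'\<close> leaves the
    correlation at their distance, up to boundary terms; conjugation covers
    \<open>l' < l\<close>.\<close>
  have cc: "cmod (\<Sum>n=1..N. u (n + l) * cnj (u (n + l'))) \<le> c ((l - l') + (l' - l)) + 2 * real L * B\<^sup>2"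
    if "l < L" "l' < L" for l l'
  proof -
    have *: "cmod (\<Sum>n=1..N. u (n + l) * cnj (u (n + l + d))) \<le> c d + 2 * real L * B\<^sup>2"
      if "l < L" for l d
    proof -
      have "cmod (u n * cnj (u (n + d))) \<le> B\<^sup>2" for n
        unfolding norm_mult complex_mod_cnj power2_eq_square using B B0 by (intro mult_mono) auto
      from norm_sum_shift_diff1[of "\<lambda>n. u n * cnj (u (n + d))", OF this, of l N]
      have "cmod (\<Sum>n=1..N. u (n + l) * cnj (u (n + l + d))) \<le> c d + 2 * real l * B\<^sup>2"
        unfolding c_def
        by (smt (verit) norm_triangle_sub)
      also have "\<dots> \<le> c d + 2 * real L * B\<^sup>2"
        using that by (intro add_left_mono mult_right_mono) auto
      finally show ?thesis .
    qed
    show ?thesis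
    proof (cases "l \<le> l'")
      case True
      then show ?thesis using *[of l "l' - l"] that by (simp add: add.assoc)
    next
      case False
      have "(\<Sum>n=1..N. u (n + l) * cnj (u (n + l')))
          = cnj (\<Sum>n=1..N. u (n + l') * cnj (u (n + l' + (l - l'))))"
        using False by (simp add: mult.commute add.assoc)
      then show ?thesis using *[of l' "l - l'"] that False by (metis (no_types, lifting) add_0_right complex_mod_cnj diff_is_0_eq' nat_le_linear)
    qed
  qed
  have "of_real (\<Sum>n=1..N. (cmod (y n))\<^sup>2) = (\<Sum>n=1..N. y n * cnj (y n))"
    by (simp add: complex_norm_square del: of_real_power)
  also have "\<dots> = (\<Sum>n=1..N. \<Sum>l<L. \<Sum>l'<L. u (n + l) * cnj (u (n + l')))"
    by (simp add: y_def sum_product)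
  also have "\<dots> = (\<Sum>l<L. \<Sum>n=1..N. \<Sum>l'<L. u (n + l) * cnj (u (n + l')))"
    by (rule sum.swap)
  also have "\<dots> = (\<Sum>l<L. \<Sum>l'<L. \<Sum>n=1..N. u (n + l) * cnj (u (n + l')))"
    by (intro sum.cong refl sum.swap)
  finally have "(\<Sum>n=1..N. (cmod (y n))\<^sup>2)
      = cmod (\<Sum>l<L. \<Sum>l'<L. \<Sum>n=1..N. u (n + l) * cnj (u (n + l')))"
    by (metis (no_types, lifting) abs_of_nonneg norm_of_real sum_nonneg zero_le_power2)
  also have "\<dots> \<le> (\<Sum>l<L. \<Sum>l'<L. c ((l - l') + (l' - l)) + 2 * real L * B\<^sup>2)"
    by (intro order_trans[OF norm_sum] sum_mono cc) auto
  also have "\<dots> \<le> 2 * real L * (\<Sum>d<L. c d) + 2 * (real L)^3 * B\<^sup>2"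
    using sum_symmetric_difference_le[of c L]
    by (simp add: sum.distrib c_def power3_eq_cube)
  finally have 4: "X\<^sup>2 \<le> N * (2 * real L * (\<Sum>d<L. c d) + 2 * (real L)^3 * B\<^sup>2)"
    using 3 N by (smt (verit) mult_left_mono of_nat_0_le_iff)
  have "(real L)\<^sup>2 * (cmod s)\<^sup>2 \<le> 4 * N * L * (\<Sum>d<L. c d) + 4 * N * (real L)^3 * B\<^sup>2 + 8 * (real L)^4 * B\<^sup>2"
    using 2 4 by (simp add: algebra_simps)
  also have "\<dots> \<le> 4 * N * L * (\<Sum>d<L. c d) + 12 * N * (real L)^4 * B\<^sup>2"
  proof -
    have "(real L)^3 \<le> (real L)^4" using L by (intro power_increasing) auto
    then have "4 * N * (real L)^3 * B\<^sup>2 \<le> 4 * N * (real L)^4 * B\<^sup>2"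
      by (intro mult_right_mono mult_left_mono) auto
    moreover have "8 * (real L)^4 * B\<^sup>2 \<le> 8 * N * (real L)^4 * B\<^sup>2"
      using N by (intro mult_right_mono) auto
    ultimately show ?thesis by linarith
  qed
  finally have "(cmod s)\<^sup>2 / N\<^sup>2
      \<le> (4 * N * L * (\<Sum>d<L. c d) + 12 * N * (real L)^4 * B\<^sup>2) / ((real L)\<^sup>2 * N\<^sup>2)"
    using L N by (simp add: field_simps)
  also have "\<dots> = 4 / L * (\<Sum>d<L. c d / N) + 12 * (real L)\<^sup>2 * B\<^sup>2 / N"
    using L N unfolding sum_divide_distrib[symmetric]
    by (simp add: field_simps power2_eq_square power4_eq_xxxx)
  finally show ?thesis by (simp add: s_def c_def power_divide)
qed

section \<open>Discrete Fourier transform modulo P\<close>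

lemma sum_cis_roots_of_unity:
  fixes d :: int
  assumes "P > 0"
  shows "(\<Sum>j<P. cis (2 * pi * (real j * of_int d) / real P)) = (if int P dvd d then of_nat P else 0)"
proof (cases "int P dvd d")
  case True
  then obtain q where "d = int P * q" by auto
  then have "cis (2 * pi * (real j * of_int d) / real P) = 1" for j :: nat
    using assms cis_multiple_2pi[of "real j * of_int q"] by (simp add: field_simps)
  with True show ?thesis by simp
next
  case False
  define w where "w = cis (2 * pi * of_int d / real P)"
  have w: "cis (2 * pi * (real j * of_int d) / real P) = w ^ j" for j
    unfolding w_def Complex.DeMoivre by (rule arg_cong[of _ _ cis]) (simp add: field_simps)
  have "w ^ P = 1"
    using assms cis_multiple_2pi[of "of_int d"] by (simp add: w_def Complex.DeMoivre)
  moreover have "w \<noteq> 1"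
  proof
    assume "w = 1"
    then obtain q :: int where "2 * pi * of_int d / real P = 2 * pi * of_int q"
      unfolding w_def by (auto simp: complex_eq_iff cos_one_2pi_int mult.commute)
    then have "of_int d = (of_int (int P * q) :: real)"
      using assms by (simp add: field_simps)
    then have "d = int P * q" by linarith
    with False show False by simp
  qed
  ultimately show ?thesis using False geometric_sum[of w P] by (simp add: w)
qed

text \<open>By \<open>inj\<close> the elements of \<open>A\<close> are distinct residues modulo
  \<open>P\<close>, so the exponentials are orthogonal. \<open>A\<close> is general because both
  \<open>{1..P}\<close> and \<open>{..<P}\<close> occur below.\<close>

lemma parseval_finite:
  fixes v :: "nat \<Rightarrow> complex"
  assumes P: "P > 0" and A: "finite A"
    and inj: "\<And>a b. a \<in> A \<Longrightarrow> b \<in> A \<Longrightarrow> int P dvd int a - int b \<Longrightarrow> a = b"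
  shows "(\<Sum>j<P. (cmod (\<Sum>n\<in>A. v n * cis (2 * pi * (real j * real n) / real P)))\<^sup>2)
    = real P * (\<Sum>n\<in>A. (cmod (v n))\<^sup>2)"
proof -
  define e where "e j n = cis (2 * pi * (real j * real n) / real P)" for j n :: nat
  have ee: "(\<Sum>j<P. e j a * cnj (e j b)) = (if a = b then of_nat P else 0)" if "a \<in> A" "b \<in> A" for a b
  proof -
    have "e j a * cnj (e j b) = cis (2 * pi * (real j * of_int (int a - int b)) / real P)" for j
      unfolding e_def cis_cnj cis_mult by (rule arg_cong[of _ _ cis]) (simp add: algebra_simps diff_divide_distrib add_divide_distrib)
    then show ?thesis using sum_cis_roots_of_unity[OF P, of "int a - int b"] inj[OF that] by auto
  qed
  have "of_real (\<Sum>j<P. (cmod (\<Sum>n\<in>A. v n * e j n))\<^sup>2)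
      = (\<Sum>j<P. (\<Sum>n\<in>A. v n * e j n) * cnj (\<Sum>n\<in>A. v n * e j n))"
    by (simp add: complex_norm_square del: of_real_power)
  also have "\<dots> = (\<Sum>j<P. \<Sum>a\<in>A. \<Sum>b\<in>A. v a * cnj (v b) * (e j a * cnj (e j b)))"
    by (simp add: sum_product mult_ac)
  also have "\<dots> = (\<Sum>a\<in>A. \<Sum>j<P. \<Sum>b\<in>A. v a * cnj (v b) * (e j a * cnj (e j b)))"
    by (rule sum.swap)
  also have "\<dots> = (\<Sum>a\<in>A. \<Sum>b\<in>A. \<Sum>j<P. v a * cnj (v b) * (e j a * cnj (e j b)))"
    by (intro sum.cong refl sum.swap)
  also have "\<dots> = (\<Sum>a\<in>A. \<Sum>b\<in>A. if a = b then v a * cnj (v b) * of_nat P else 0)"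
    by (intro sum.cong refl) (simp add: sum_distrib_left[symmetric] ee)
  also have "\<dots> = (\<Sum>a\<in>A. v a * cnj (v a) * of_nat P)"
    using A by simp
  also have "\<dots> = of_real (real P * (\<Sum>n\<in>A. (cmod (v n))\<^sup>2))"
    by (simp add: complex_norm_square sum_distrib_left sum_distrib_right mult_ac del: of_real_power)
  finally show ?thesis unfolding e_def of_real_eq_iff .
qed

text \<open>In the discrete Fourier transform modulo \<open>2 N\<close> the correlations become coefficients of
  a pointwise product; the modulus is large enough to exclude wrap-around.\<close>

lemma correlation_square_sum_le:
  fixes u :: "nat \<Rightarrow> complex"
  assumes B: "\<And>n. cmod (u n) \<le> B" and N: "N > 0"
    and w: "\<And>t::real. (cmod (\<Sum>n=1..N. cis (2 * pi * (real n * t)) * u n))\<^sup>2 \<le> w"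
  shows "(\<Sum>h=1..N. (cmod (\<Sum>n=1..N. u n * cnj (u (n + h))))\<^sup>2) \<le> 2 * real N * B\<^sup>2 * w"
proof -
  define P where "P = 2 * N"
  have P: "P > 0" using N by (simp add: P_def)
  define e where "e j n = cis (2 * pi * (real j * real n) / real P)" for j n :: nat
  define U where "U j = (\<Sum>n=1..N. u n * e j n)" for j
  define V where "V j = (\<Sum>n=1..P. u n * e j n)" for j
  have U: "(cmod (U j))\<^sup>2 \<le> w" for j
    using w[of "real j / real P"] by (simp add: U_def e_def mult_ac)
  have V: "(\<Sum>j<P. (cmod (V j))\<^sup>2) = real P * (\<Sum>n=1..P. (cmod (u n))\<^sup>2)"
    unfolding V_def e_def
  proof (rule parseval_finite[OF P])
    fix a b assume "a \<in> {1..P}" "b \<in> {1..P}" "int P dvd int a - int b"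
    moreover from this have "\<bar>int a - int b\<bar> < int P" by auto
    ultimately show "a = b"
      by (metis abs_of_nat dvd_imp_le_int not_le right_minus_eq of_nat_eq_iff)
  qed simp
  have ee: "(\<Sum>j<P. e j n * cnj (e j n') * e j h) = (if n' = n + h then of_nat P else 0)"
    if "n \<in> {1..N}" "n' \<in> {1..P}" "h \<in> {1..N}" for n n' h
  proof -
    have "e j n * cnj (e j n') * e j h = cis (2 * pi * (real j * of_int (int n - int n' + int h)) / real P)" for j
      unfolding e_def cis_cnj cis_mult by (rule arg_cong[of _ _ cis]) (simp add: algebra_simps diff_divide_distrib add_divide_distrib)
    moreover have "int P dvd int n - int n' + int h \<longleftrightarrow> n' = n + h"
    proof
      assume "int P dvd int n - int n' + int h"
      moreover have "\<bar>int n - int n' + int h\<bar> < int P" using that by (auto simp: P_def)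
      ultimately have "int n - int n' + int h = 0"
        by (metis abs_of_nat dvd_imp_le_int not_le)
      then show "n' = n + h" by linarith
    qed simp
    ultimately show ?thesis using sum_cis_roots_of_unity[OF P, of "int n - int n' + int h"] by simp
  qed
  have c: "(\<Sum>j<P. U j * cnj (V j) * e j h) = of_nat P * (\<Sum>n=1..N. u n * cnj (u (n + h)))"
    if h: "h \<in> {1..N}" for h
  proof -
    have "(\<Sum>j<P. U j * cnj (V j) * e j h)
        = (\<Sum>j<P. \<Sum>n=1..N. \<Sum>n'=1..P. u n * cnj (u n') * (e j n * cnj (e j n') * e j h))"
      unfolding U_def V_def cnj_sum sum_product unfolding sum_distrib_right by (simp add: mult_ac)
    also have "\<dots> = (\<Sum>n=1..N. \<Sum>j<P. \<Sum>n'=1..P. u n * cnj (u n') * (e j n * cnj (e j n') * e j h))"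
      by (rule sum.swap)
    also have "\<dots> = (\<Sum>n=1..N. \<Sum>n'=1..P. \<Sum>j<P. u n * cnj (u n') * (e j n * cnj (e j n') * e j h))"
      by (intro sum.cong refl sum.swap)
    also have "\<dots> = (\<Sum>n=1..N. \<Sum>n'=1..P. if n' = n + h then u n * cnj (u n') * of_nat P else 0)"
      by (intro sum.cong refl) (simp only: sum_distrib_left[symmetric] ee[OF _ _ h], simp)
    also have "\<dots> = (\<Sum>n=1..N. u n * cnj (u (n + h)) * of_nat P)"
      using h by (intro sum.cong refl) (auto simp: P_def)
    finally show ?thesis by (simp add: sum_distrib_left mult_ac)
  qed
  have B0: "0 \<le> B" using B[of 0] norm_ge_zero order_trans by blast
  have w0: "0 \<le> w" using U[of 0] zero_le_power2 order_trans by blast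
  have "(\<Sum>h=1..N. (real P)\<^sup>2 * (cmod (\<Sum>n=1..N. u n * cnj (u (n + h))))\<^sup>2)
      = (\<Sum>h=1..N. (cmod (\<Sum>j<P. U j * cnj (V j) * e j h))\<^sup>2)"
    by (intro sum.cong refl) (simp add: c norm_mult power_mult_distrib)
  \<comment> \<open>Completing \<open>{1..N}\<close> to all residues only adds nonnegative terms and
    permits Parseval a second time, now with \<open>h\<close> as frequency and \<open>j\<close> as
    index.\<close>
  also have "\<dots> \<le> (\<Sum>h<P. (cmod (\<Sum>j<P. U j * cnj (V j) * e j h))\<^sup>2)"
    by (intro sum_mono2) (auto simp: P_def)
  also have "\<dots> = (\<Sum>h<P. (cmod (\<Sum>j<P. U j * cnj (V j) * cis (2 * pi * (real h * real j) / real P)))\<^sup>2)"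
    by (simp add: e_def mult_ac)
  also have "\<dots> = real P * (\<Sum>j<P. (cmod (U j * cnj (V j)))\<^sup>2)"
  proof (rule parseval_finite[OF P])
    fix a b assume "a \<in> {..<P}" "b \<in> {..<P}" "int P dvd int a - int b"
    moreover from this have "\<bar>int a - int b\<bar> < int P" by auto
    ultimately show "a = b"
      by (metis abs_of_nat dvd_imp_le_int not_le right_minus_eq of_nat_eq_iff)
  qed simp
  also have "\<dots> \<le> real P * (\<Sum>j<P. w * (cmod (V j))\<^sup>2)"
    using U by (intro mult_left_mono sum_mono) (auto simp: norm_mult power_mult_distrib intro!: mult_right_mono)
  also have "\<dots> = (real P)\<^sup>2 * w * (\<Sum>n=1..P. (cmod (u n))\<^sup>2)"
    by (simp only: sum_distrib_left[symmetric] V) (simp add: power2_eq_square)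
  also have "\<dots> \<le> (real P)\<^sup>2 * w * (\<Sum>n=1..P. B\<^sup>2)"
    using B B0 w0 by (intro mult_left_mono sum_mono power_mono) auto
  finally have "(real P)\<^sup>2 * (\<Sum>h=1..N. (cmod (\<Sum>n=1..N. u n * cnj (u (n + h))))\<^sup>2)
      \<le> (real P)\<^sup>2 * (2 * real N * B\<^sup>2 * w)"
    by (simp add: sum_distrib_left P_def mult_ac)
  then show ?thesis using P by simp
qed

section \<open>Averages of positive definite sequences\<close>

definition psd_kernel :: "(nat \<Rightarrow> nat \<Rightarrow> real) \<Rightarrow> bool" where
  "psd_kernel K \<longleftrightarrow> (\<forall>I c. finite I \<longrightarrow> 0 \<le> (\<Sum>i\<in>I. \<Sum>j\<in>I. c i * c j * K i j))"

text \<open>The points \<open>p a\<close> may coincide: \<open>C\<close> collects the coefficients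
  over each fibre of \<open>p\<close>, which brings the form into the shape of the
  definition.\<close>

lemma psd_kernel_family:
  assumes K: "psd_kernel K" and I: "finite I"
  shows "0 \<le> (\<Sum>a\<in>I. \<Sum>b\<in>I. c a * c b * K (p a) (p b))"
proof -
  define C where "C i = (\<Sum>a\<in>{a\<in>I. p a = i}. c a)" for i
  have "(\<Sum>a\<in>I. \<Sum>b\<in>I. c a * c b * K (p a) (p b)) = (\<Sum>a\<in>I. \<Sum>j\<in>p ` I. c a * C j * K (p a) j)"
  proof (intro sum.cong refl)
    fix a
    have "(\<Sum>b\<in>I. c a * c b * K (p a) (p b))
        = (\<Sum>j\<in>p ` I. \<Sum>b\<in>{b\<in>I. p b = j}. c a * c b * K (p a) (p b))"
      by (rule sum.image_gen[OF I])
    also have "\<dots> = (\<Sum>j\<in>p ` I. c a * C j * K (p a) j)"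
      by (intro sum.cong refl) (simp add: C_def sum_distrib_left sum_distrib_right)
    finally show "(\<Sum>b\<in>I. c a * c b * K (p a) (p b)) = (\<Sum>j\<in>p ` I. c a * C j * K (p a) j)" .
  qed
  also have "\<dots> = (\<Sum>i\<in>p ` I. \<Sum>a\<in>{a\<in>I. p a = i}. \<Sum>j\<in>p ` I. c a * C j * K (p a) j)"
    by (rule sum.image_gen[OF I])
  also have "\<dots> = (\<Sum>i\<in>p ` I. \<Sum>j\<in>p ` I. C i * C j * K i j)"
  proof (intro sum.cong refl)
    fix i
    have "(\<Sum>a\<in>{a\<in>I. p a = i}. \<Sum>j\<in>p ` I. c a * C j * K (p a) j)
        = (\<Sum>j\<in>p ` I. \<Sum>a\<in>{a\<in>I. p a = i}. c a * C j * K (p a) j)"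
      by (rule sum.swap)
    also have "\<dots> = (\<Sum>j\<in>p ` I. C i * C j * K i j)"
      by (intro sum.cong refl) (simp add: C_def sum_distrib_right)
    finally show "(\<Sum>a\<in>{a\<in>I. p a = i}. \<Sum>j\<in>p ` I. c a * C j * K (p a) j)
        = (\<Sum>j\<in>p ` I. C i * C j * K i j)" .
  qed
  finally show ?thesis using K I unfolding psd_kernel_def by simp
qed

text \<open>The disjoint sum concatenates two weighted families and keeps them apart even when
  points coincide; symmetry merges the two cross terms.\<close>

lemma psd_kernel_sum_Plus:
  fixes K :: "nat \<Rightarrow> nat \<Rightarrow> real"
  assumes sym: "\<And>i j. K i j = K j i" and "finite I" "finite J"
  shows "(\<Sum>a\<in>I <+> J. \<Sum>b\<in>I <+> J. case_sum c d a * case_sum c d b * K (case_sum p q a) (case_sum p q b))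
    = (\<Sum>i\<in>I. \<Sum>i'\<in>I. c i * c i' * K (p i) (p i')) + (\<Sum>j\<in>J. \<Sum>j'\<in>J. d j * d j' * K (q j) (q j'))
      + 2 * (\<Sum>i\<in>I. \<Sum>j\<in>J. c i * d j * K (p i) (q j))"
proof -
  have "(\<Sum>j\<in>J. \<Sum>i\<in>I. d j * c i * K (q j) (p i)) = (\<Sum>i\<in>I. \<Sum>j\<in>J. c i * d j * K (p i) (q j))"
    by (subst sum.swap) (simp add: sym[of "q _" "p _"] mult_ac)
  then show ?thesis using assms by (simp add: sum.Plus sum.distrib)
qed

text \<open>For a Gram matrix this is 2<u,v> \<le> |u|^2 + |v|^2. It is positivity for the
  concatenated family with the second weights negated.\<close>

lemma psd_kernel_two_mult_le:
  assumes K: "psd_kernel K" and sym: "\<And>i j. K i j = K j i" and I: "finite I" and J: "finite J"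
  shows "2 * (\<Sum>i\<in>I. \<Sum>j\<in>J. c i * d j * K (p i) (q j))
    \<le> (\<Sum>i\<in>I. \<Sum>i'\<in>I. c i * c i' * K (p i) (p i')) + (\<Sum>j\<in>J. \<Sum>j'\<in>J. d j * d j' * K (q j) (q j'))"
  using psd_kernel_family[OF K, of "I <+> J" "case_sum c (\<lambda>j. - d j)" "case_sum p q"]
    psd_kernel_sum_Plus[where K = K and c = c and d = "\<lambda>j. - d j" and p = p and q = q, OF sym I J] I J
  by (simp add: sum_negf)

section \<open>Riesz's ergodic argument for the Gram kernel of an orbit\<close>

text \<open>The model is the Gram matrix of an orbit U^i v of an isometry U of a real Hilbert space;
  stationarity says that U preserves inner products. Only the kernel is used, so no such space has
  to be constructed.\<close>

locale stationary_psd_kernel =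
  fixes K :: "nat \<Rightarrow> nat \<Rightarrow> real" and b :: real
  assumes psd: "psd_kernel K"
    and sym: "K i j = K j i"
    and stationary: "K (Suc i) (Suc j) = K i j"
    and bounded: "\<bar>K i j\<bar> \<le> b"
begin

lemma b_nonneg: "0 \<le> b"
  using bounded[of 0 0] by simp

lemma shift: "K (i + k) (j + k) = K i j"
  by (induction k) (simp_all add: stationary)

lemma shift': "K (k + i) (k + j) = K i j"
  using shift[of i k j] by (simp add: add.commute)

text \<open>In the Hilbert space picture, the inner product of the Cesaro means A_N and A_N' of the
  orbit; on the diagonal it is |A_N|^2.\<close>

definition avg :: "nat \<Rightarrow> nat \<Rightarrow> real" where
  "avg N N' = (\<Sum>i<N. \<Sum>j<N'. K i j) / (real N * real N')"

lemma sum_shift_le: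
  "\<bar>(\<Sum>k<J. \<Sum>k'<J. K (k + i) (k' + j)) - (\<Sum>k<J. \<Sum>k'<J. K k k')\<bar> \<le> 2 * (real i + real j) * b * real J"
proof -
  have *: "\<bar>(\<Sum>k<J. F (k + i)) - (\<Sum>k<J. F k)\<bar> \<le> 2 * real i * b" if "\<And>k. \<bar>F k\<bar> \<le> b" for F :: "nat \<Rightarrow> real" and i
    using norm_sum_shift_diff[of F b i J] that by simp
  have **: "\<bar>(\<Sum>k<J. F k) - (\<Sum>k<J. G k)\<bar> \<le> (\<Sum>k<J. c)" if "\<And>k. \<bar>F k - G k\<bar> \<le> c"
    for F G :: "nat \<Rightarrow> real" and c
    unfolding sum_subtractf[symmetric] by (intro order_trans[OF sum_abs] sum_mono that)
  have "\<bar>(\<Sum>k<J. \<Sum>k'<J. K (k + i) (k' + j)) - (\<Sum>k<J. \<Sum>k'<J. K (k + i) k')\<bar> \<le> (\<Sum>k<J. 2 * real j * b)"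
    by (intro ** *[OF bounded])
  moreover have "\<bar>(\<Sum>k<J. \<Sum>k'<J. K (k + i) k') - (\<Sum>k<J. \<Sum>k'<J. K k k')\<bar> \<le> (\<Sum>k'<J. 2 * real i * b)"
  proof -
    have s1: "(\<Sum>k<J. \<Sum>k'<J. K (k + i) k') = (\<Sum>k'<J. \<Sum>k<J. K (k + i) k')"
      and s2: "(\<Sum>k<J. \<Sum>k'<J. K k k') = (\<Sum>k'<J. \<Sum>k<J. K k k')"
      by (rule sum.swap)+
    show ?thesis
      unfolding s1 s2 by (intro ** *[OF bounded])
  qed
  ultimately show ?thesis by (simp add: algebra_simps)
qed

text \<open>Averaging the translates of a probability vector does not increase its norm, by convexity, and
  turns it into an almost uniform vector.\<close>

lemma avg_diag_le:
  assumes I: "finite I" and c: "\<And>a. a \<in> I \<Longrightarrow> 0 \<le> c a" "(\<Sum>a\<in>I. c a) = 1"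
    and p: "\<And>a. a \<in> I \<Longrightarrow> p a \<le> n" and J: "J > 0"
  shows "avg J J \<le> (\<Sum>a\<in>I. \<Sum>a'\<in>I. c a * c a' * K (p a) (p a')) + 4 * b * real n / real J"
proof -
  define q where "q = (\<Sum>a\<in>I. \<Sum>a'\<in>I. c a * c a' * K (p a) (p a'))"
  define R where "R a a' = (\<Sum>k<J. \<Sum>k'<J. K (k + p a) (k' + p a'))" for a a'
  \<comment> \<open>The two translated families have the same weights and, by stationarity, the same
    form \<open>q\<close>, so their cross form is at most \<open>q\<close>: this is the
    convexity.\<close>
  have "(\<Sum>a\<in>I. \<Sum>a'\<in>I. c a * c a' * K (k + p a) (k' + p a')) \<le> q" for k k'
    using psd_kernel_two_mult_le[OF psd sym I I, of c c "\<lambda>a. k + p a" "\<lambda>a. k' + p a"]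
    by (simp add: q_def shift')
  then have "(\<Sum>k<J. \<Sum>k'<J. \<Sum>a\<in>I. \<Sum>a'\<in>I. c a * c a' * K (k + p a) (k' + p a')) \<le> (\<Sum>k<J. \<Sum>k'<J. q)"
    by (intro sum_mono)
  also have "(\<Sum>k<J. \<Sum>k'<J. \<Sum>a\<in>I. \<Sum>a'\<in>I. c a * c a' * K (k + p a) (k' + p a'))
      = (\<Sum>a\<in>I. \<Sum>a'\<in>I. \<Sum>k<J. \<Sum>k'<J. c a * c a' * K (k + p a) (k' + p a'))"
  proof -
    let ?f = "\<lambda>k k' a a'. c a * c a' * K (k + p a) (k' + p a')"
    have "(\<Sum>k<J. \<Sum>k'<J. \<Sum>a\<in>I. \<Sum>a'\<in>I. ?f k k' a a') = (\<Sum>k<J. \<Sum>a\<in>I. \<Sum>k'<J. \<Sum>a'\<in>I. ?f k k' a a')"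
      by (intro sum.cong refl sum.swap)
    also have "\<dots> = (\<Sum>a\<in>I. \<Sum>k<J. \<Sum>k'<J. \<Sum>a'\<in>I. ?f k k' a a')"
      by (rule sum.swap)
    also have "\<dots> = (\<Sum>a\<in>I. \<Sum>k<J. \<Sum>a'\<in>I. \<Sum>k'<J. ?f k k' a a')"
      by (intro sum.cong refl sum.swap)
    also have "\<dots> = (\<Sum>a\<in>I. \<Sum>a'\<in>I. \<Sum>k<J. \<Sum>k'<J. ?f k k' a a')"
      by (intro sum.cong refl sum.swap)
    finally show ?thesis .
  qed
  also have "\<dots> = (\<Sum>a\<in>I. \<Sum>a'\<in>I. c a * c a' * R a a')"
    by (simp add: R_def sum_distrib_left)
  finally have 1: "(\<Sum>a\<in>I. \<Sum>a'\<in>I. c a * c a' * R a a') \<le> real J * real J * q" by simp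
  define D where "D = (\<Sum>k<J. \<Sum>k'<J. K k k')"
  have R: "D - 4 * real n * b * real J \<le> R a a'" if "a \<in> I" "a' \<in> I" for a a'
  proof -
    have "2 * (real (p a) + real (p a')) * b * real J \<le> 4 * real n * b * real J"
      using p[OF that(1)] p[OF that(2)] b_nonneg by (intro mult_right_mono) auto
    then show ?thesis using sum_shift_le[where i = "p a" and j = "p a'" and J = J] by (simp add: R_def D_def)
  qed
  have "D - 4 * real n * b * real J = (\<Sum>a\<in>I. \<Sum>a'\<in>I. c a * c a' * (D - 4 * real n * b * real J))"
    by (simp add: sum_distrib_right[symmetric] sum_distrib_left[symmetric] c)
  also have "\<dots> \<le> (\<Sum>a\<in>I. \<Sum>a'\<in>I. c a * c a' * R a a')"
    using c R by (intro sum_mono mult_left_mono) auto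
  finally have "D \<le> real J * real J * q + 4 * real n * b * real J" using 1 by linarith
  then have "D / (real J * real J) \<le> (real J * real J * q + 4 * real n * b * real J) / (real J * real J)"
    by (intro divide_right_mono) auto
  also have "\<dots> = q + 4 * b * real n / real J"
    using J by (simp add: field_simps)
  finally show ?thesis by (simp add: avg_def q_def D_def)
qed

lemma avg_diag_nonneg: "0 \<le> avg N N"
  using psd_kernel_family[OF psd, of "{..<N}" "\<lambda>_. 1" "\<lambda>i. i"] by (simp add: avg_def)

text \<open>The squared minimal norm on the convex hull of the orbit, hence that of its projection
  to the invariant vectors. \<open>N = 0\<close> is left out because \<open>avg 0 0\<close> is 0 by
  the convention for division.\<close>

definition lim_value :: real where
  "lim_value = (INF N\<in>{0<..}. avg N N)"

lemma lim_value_le: "N > 0 \<Longrightarrow> lim_value \<le> avg N N"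
  unfolding lim_value_def by (intro cINF_lower) (auto intro!: bdd_belowI2[of _ 0] avg_diag_nonneg)

text \<open>Let \<open>J\<close> tend to infinity in \<open>avg_diag_le\<close>: no convex
  combination of orbit vectors is shorter than the infimum over the Cesaro means.\<close>

lemma lim_value_le_quadratic:
  assumes I: "finite I" and c: "\<And>a. a \<in> I \<Longrightarrow> 0 \<le> c a" "(\<Sum>a\<in>I. c a) = 1"
  shows "lim_value \<le> (\<Sum>a\<in>I. \<Sum>a'\<in>I. c a * c a' * K (p a) (p a'))" (is "_ \<le> ?q")
proof -
  obtain n where n: "\<And>a. a \<in> I \<Longrightarrow> p a \<le> n"
    using I by (meson finite_imageI finite_nat_set_iff_bounded_le imageI)
  have "(\<lambda>J. ?q + 4 * b * real n / real J) \<longlonglongrightarrow> ?q + 0"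
    by (intro tendsto_intros lim_const_over_n)
  moreover have "eventually (\<lambda>J. lim_value \<le> ?q + 4 * b * real n / real J) sequentially"
    using eventually_gt_at_top[of 0]
    by eventually_elim (rule order_trans[OF lim_value_le avg_diag_le[OF I c n]], auto)
  ultimately show ?thesis
    using tendsto_lowerbound[of _ "?q + 0" sequentially lim_value] by simp
qed

lemma two_avg_le:
  assumes "N > 0" "N' > 0"
  shows "2 * avg N N' \<le> avg N N + avg N' N'"
  using psd_kernel_two_mult_le[OF psd sym, of "{..<N}" "{..<N'}" "\<lambda>_. 1 / N" "\<lambda>_. 1 / N'" "\<lambda>i. i" "\<lambda>i. i"]
  by (simp add: avg_def sum_divide_distrib power2_eq_square)

text \<open>The midpoint of A_N and A_N' is again a convex combination, whence the weights 1/(2N)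
  and 1/(2N'). With \<open>two_avg_le\<close> this confines \<open>avg N N'\<close> once both
  diagonal values are close to the infimum.\<close>

lemma lim_value_le_avg_mixed:
  assumes N: "N > 0" "N' > 0"
  shows "4 * lim_value \<le> avg N N + avg N' N' + 2 * avg N N'"
proof -
  have "lim_value \<le> (\<Sum>a\<in>{..<N} <+> {..<N'}. \<Sum>a'\<in>{..<N} <+> {..<N'}.
      case_sum (\<lambda>_. 1 / (2 * N)) (\<lambda>_. 1 / (2 * N')) a * case_sum (\<lambda>_. 1 / (2 * N)) (\<lambda>_. 1 / (2 * N')) a'
      * K (case_sum (\<lambda>i. i) (\<lambda>i. i) a) (case_sum (\<lambda>i. i) (\<lambda>i. i) a'))"
  proof (rule lim_value_le_quadratic)
    show "(\<Sum>a\<in>{..<N} <+> {..<N'}. case_sum (\<lambda>_. 1 / real (2 * N)) (\<lambda>_. 1 / real (2 * N')) a) = 1"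
      using N by (simp add: sum.Plus)
  qed (auto split: sum.splits)
  also have "\<dots> = (avg N N + avg N' N' + 2 * avg N N') / 4"
  proof -
    have factor: "(\<Sum>i<n. \<Sum>j<n'. x * y * K i j) = x * y * (\<Sum>i<n. \<Sum>j<n'. K i j)" for n n' x y
      by (simp add: sum_distrib_left)
    show ?thesis
      using N by (simp only: psd_kernel_sum_Plus[where K = K, OF sym finite_lessThan finite_lessThan] factor)
        (simp add: avg_def field_simps)
  qed
  finally show ?thesis by simp
qed

text \<open>By stationarity row \<open>i\<close> is row 0 delayed by \<open>i\<close> places, so for
  fixed \<open>N\<close> and large \<open>N'\<close> the rows have nearly the same mean.\<close>

lemma avg_row_approx:
  assumes N: "N > 0" "N' > 0"
  shows "\<bar>avg N N' - (\<Sum>j<N'. K 0 j) / N'\<bar> \<le> 2 * b * N / N'"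
proof -
  have row: "\<bar>(\<Sum>j<N'. K i j) - (\<Sum>j<N'. K 0 j)\<bar> \<le> 2 * b * N" if "i < N" for i
  proof -
    have "\<bar>(\<Sum>j<N'. K i (j + i)) - (\<Sum>j<N'. K i j)\<bar> \<le> 2 * real i * b"
      using norm_sum_shift_diff[of "K i" b i N'] bounded by simp
    moreover have "K i (j + i) = K 0 j" for j using shift[of 0 i j] by simp
    moreover have "2 * real i * b \<le> 2 * real N * b"
      using that b_nonneg by (intro mult_right_mono) auto
    ultimately show ?thesis by (simp add: mult_ac)
  qed
  have "\<bar>(\<Sum>i<N. \<Sum>j<N'. K i j) - N * (\<Sum>j<N'. K 0 j)\<bar> = \<bar>\<Sum>i<N. (\<Sum>j<N'. K i j) - (\<Sum>j<N'. K 0 j)\<bar>"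
    by (simp add: sum_subtractf)
  also have "\<dots> \<le> (\<Sum>i<N. 2 * b * N)"
    by (intro order_trans[OF sum_abs] sum_mono row) auto
  finally have "\<bar>(\<Sum>i<N. \<Sum>j<N'. K i j) - N * (\<Sum>j<N'. K 0 j)\<bar> / (N * N') \<le> 2 * b * N * N / (N * N')"
    by (intro divide_right_mono) (simp_all add: mult_ac)
  also have "\<bar>(\<Sum>i<N. \<Sum>j<N'. K i j) - N * (\<Sum>j<N'. K 0 j)\<bar> / (N * N')
      = \<bar>avg N N' - (\<Sum>j<N'. K 0 j) / N'\<bar>"
  proof -
    have "\<bar>(\<Sum>i<N. \<Sum>j<N'. K i j) - N * (\<Sum>j<N'. K 0 j)\<bar> / (N * N')
        = \<bar>((\<Sum>i<N. \<Sum>j<N'. K i j) - N * (\<Sum>j<N'. K 0 j)) / (real N * real N')\<bar>"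
      by simp
    then show ?thesis using N by (simp add: avg_def diff_divide_distrib)
  qed
  finally show ?thesis using N by (simp add: field_simps)
qed

text \<open>One \<open>N\<close> with a nearly minimal value controls all large \<open>J\<close>
  through \<open>avg_diag_le\<close>, applied to the uniform weights on
  \<open>{..<N}\<close>.\<close>

lemma avg_tendsto: "(\<lambda>N. avg N N) \<longlonglongrightarrow> lim_value"
proof (rule order_tendstoI)
  fix a assume "a < lim_value"
  then show "eventually (\<lambda>N. a < avg N N) sequentially"
    by (intro eventually_mono[OF eventually_gt_at_top[of 0]]) (rule less_le_trans[OF _ lim_value_le])
next
  fix a assume "lim_value < a"
  then obtain N where N: "N > 0" "avg N N < a"
    unfolding lim_value_def by (auto simp: cINF_less_iff bdd_belowI2[of _ 0] avg_diag_nonneg)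
  have "(\<lambda>J. avg N N + 4 * b * real N / real J) \<longlonglongrightarrow> avg N N + 0"
    by (intro tendsto_intros lim_const_over_n)
  then have "eventually (\<lambda>J. avg N N + 4 * b * real N / real J < a) sequentially"
    using N order_tendstoD(2) by fastforce
  then show "eventually (\<lambda>J. avg J J < a) sequentially"
    using eventually_gt_at_top[of 0]
  proof eventually_elim
    case (elim J)
    have "avg J J \<le> (\<Sum>i<N. \<Sum>i'<N. 1 / N * (1 / N) * K i i') + 4 * b * real N / real J"
      using N elim by (intro avg_diag_le) auto
    also have "(\<Sum>i<N. \<Sum>i'<N. 1 / N * (1 / N) * K i i') = avg N N"
      by (simp add: avg_def sum_divide_distrib)
    finally show ?case using elim by simp
  qed
qed

text \<open>Fix a nearly optimal \<open>N\<close> and let \<open>H\<close> grow: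
  \<open>avg N H\<close> is squeezed around \<open>lim_value\<close> and approximates the row
  average.\<close>

theorem row_average_tendsto: "(\<lambda>H. (\<Sum>j<H. K 0 j) / H) \<longlonglongrightarrow> lim_value"
proof (rule LIMSEQ_I)
  fix e :: real assume e: "e > 0"
  have "eventually (\<lambda>N. avg N N < lim_value + e / 4 \<and> 0 < N) sequentially"
    using e by (intro eventually_conj order_tendstoD(2)[OF avg_tendsto] eventually_gt_at_top) auto
  then obtain N where N: "N > 0" "avg N N < lim_value + e / 4"
    using eventually_happens'[OF sequentially_bot] by blast
  have "eventually (\<lambda>H. avg H H < lim_value + e / 4) sequentially"
    using e by (intro order_tendstoD(2)[OF avg_tendsto]) auto
  moreover have "eventually (\<lambda>H. 2 * b * real N / real H < e / 4) sequentially"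
    using e by (intro order_tendstoD(2)[OF lim_const_over_n]) auto
  ultimately have "eventually (\<lambda>H. norm ((\<Sum>j<H. K 0 j) / H - lim_value) < e) sequentially"
    using eventually_gt_at_top[of 0]
  proof eventually_elim
    case (elim H)
    have "\<bar>avg N H - (\<Sum>j<H. K 0 j) / H\<bar> < e / 4"
      using avg_row_approx[OF N(1) elim(3)] elim(2) by linarith
    moreover have "2 * avg N H \<le> 2 * lim_value + e / 2"
      using two_avg_le[OF N(1) elim(3)] N elim(1) by linarith
    moreover have "2 * avg N H \<ge> 2 * lim_value - e / 2"
      using lim_value_le_avg_mixed[OF N(1) elim(3)] N elim(1) by linarith
    ultimately show ?case unfolding real_norm_def using e by linarith
  qed
  then show "\<exists>no. \<forall>n\<ge>no. norm ((\<Sum>j<n. K 0 j) / n - lim_value) < e"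
    unfolding eventually_sequentially .
qed

text \<open>\<open>avg N N\<close> is a Fejer mean of the row \<open>K 0\<close>; for nonnegative
  entries its triangular weights are bounded by the flat weight 2/N.\<close>

lemma lim_value_le_row_average:
  assumes nonneg: "\<And>j. 0 \<le> K 0 j" and N: "N > 0"
  shows "lim_value \<le> 2 * (\<Sum>j<N. K 0 j) / N"
proof -
  have "K i j = K 0 ((i - j) + (j - i))" for i j
  proof (cases "i \<le> j")
    case True then show ?thesis using shift[of 0 i "j - i"] by simp
  next
    case False then show ?thesis using shift[of "i - j" j 0] sym[of 0 "i - j"] by simp
  qed
  then have "(\<Sum>i<N. \<Sum>j<N. K i j) = (\<Sum>i<N. \<Sum>j<N. K 0 ((i - j) + (j - i)))"
    by (intro sum.cong refl)
  also have "\<dots> \<le> 2 * real N * (\<Sum>j<N. K 0 j)"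
    by (rule sum_symmetric_difference_le[OF nonneg])
  finally have "avg N N \<le> 2 * real N * (\<Sum>j<N. K 0 j) / (real N * real N)"
    unfolding avg_def by (rule divide_right_mono) simp
  with lim_value_le[OF N] show ?thesis using N by simp
qed

end

section \<open>The pointwise ergodic theorem\<close>

context invertible_ergodic_system
begin

lemma T_pow_measurable [measurable]: "(T ^^ n) \<in> measurable M M"
  using T_measurable by (rule measurable_compose_n)

lemma T_space: "x \<in> space M \<Longrightarrow> T x \<in> space M"
  using measurable_space[OF T_measurable] .

lemma distr_T_pow: "distr M M (T ^^ n) = M"
proof (induction n)
  case (Suc n)
  have "distr M M (T ^^ Suc n) = distr (distr M M (T ^^ n)) M T"
    by (subst distr_distr[OF T_measurable T_pow_measurable]) (simp add: comp_def)
  also have "\<dots> = M" using Suc T_preserves by simp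
  finally show ?case .
qed (simp add: distr_id[unfolded id_def] id_def)

lemma integral_T_pow:
  fixes f :: "'a \<Rightarrow> 'b::{banach, second_countable_topology}"
  assumes "f \<in> borel_measurable M"
  shows "(LINT x|M. f ((T ^^ n) x)) = integral\<^sup>L M f"
  using integral_distr[OF T_pow_measurable assms, of n] distr_T_pow by simp

lemma integral_T:
  fixes f :: "'a \<Rightarrow> 'b::{banach, second_countable_topology}"
  assumes "f \<in> borel_measurable M"
  shows "(LINT x|M. f (T x)) = integral\<^sup>L M f"
  using integral_T_pow[OF assms, of 1] by simp

lemma integrable_T:
  fixes f :: "'a \<Rightarrow> 'b::{banach, second_countable_topology}"
  assumes "integrable M f"
  shows "integrable M (\<lambda>x. f (T x))"
  using assms integrable_distr[OF T_measurable, of f] T_preserves by simp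

lemma AE_T_pow: "AE x in M. P x \<Longrightarrow> AE x in M. P ((T ^^ n) x)"
  using AE_distrD[OF T_pow_measurable[of n], of P] unfolding distr_T_pow .

lemma AE_all_T_pow: "AE x in M. P x \<Longrightarrow> AE x in M. \<forall>n. P ((T ^^ n) x)"
  unfolding AE_all_countable using AE_T_pow by blast

section \<open>Maximal ergodic inequality and its consequences\<close>

text \<open>The largest Birkhoff sum over the lengths 0 to \<open>n\<close>. The empty sum makes it
  nonnegative, and peeling off the first term turns the maximum into this recursion.\<close>

primrec max_birkhoff_sum :: "('a \<Rightarrow> real) \<Rightarrow> nat \<Rightarrow> 'a \<Rightarrow> real" where
  "max_birkhoff_sum g 0 x = 0"
| "max_birkhoff_sum g (Suc n) x = max 0 (g x + max_birkhoff_sum g n (T x))"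

lemma max_birkhoff_sum_nonneg: "0 \<le> max_birkhoff_sum g n x"
  by (cases n) auto

lemma max_birkhoff_sum_mono: "m \<le> n \<Longrightarrow> max_birkhoff_sum g m x \<le> max_birkhoff_sum g n x"
proof -
  have "max_birkhoff_sum g n x \<le> max_birkhoff_sum g (Suc n) x" for n x
  proof (induction n arbitrary: x)
    case (Suc n)
    show ?case
      unfolding max_birkhoff_sum.simps(2)[of g n x] max_birkhoff_sum.simps(2)[of g "Suc n" x]
      by (intro max.mono add_left_mono order_refl Suc)
  qed simp
  then show "m \<le> n \<Longrightarrow> max_birkhoff_sum g m x \<le> max_birkhoff_sum g n x"
    by (rule lift_Suc_mono_le[of "\<lambda>n. max_birkhoff_sum g n x"])
qed

lemma birkhoff_sum_Suc: "(\<Sum>i<Suc N. g ((T ^^ i) x)) = g x + (\<Sum>i<N. g ((T ^^ i) (T x)))"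
  by (simp add: sum.lessThan_Suc_shift funpow_swap1 del: sum.lessThan_Suc)

lemma birkhoff_sum_le_max: "(\<Sum>i<N. g ((T ^^ i) x)) \<le> max_birkhoff_sum g N x"
proof (induction N arbitrary: x)
  case (Suc N)
  then show ?case unfolding birkhoff_sum_Suc by (simp add: max.coboundedI2)
qed simp

lemma integrable_max_birkhoff_sum:
  assumes "integrable M g"
  shows "integrable M (max_birkhoff_sum g n)"
proof (induction n)
  case (Suc n)
  then show ?case using assms integrable_T[OF Suc] by simp
qed (simp add: max_birkhoff_sum_def[abs_def] cong: integrable_cong)

text \<open>Garsia's argument. Where the maximum \<open>?m\<close> is positive, \<open>g x\<close>
  is \<open>?m x\<close> minus the shorter maximum at \<open>T x\<close>, hence at least
  \<open>?m x - ?m (T x)\<close>; elsewhere \<open>?m\<close> vanishes and this difference is at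
  most 0. By invariance the difference has integral 0.\<close>

lemma maximal_ergodic:
  assumes g: "integrable M g"
  shows "0 \<le> (LINT x|M. indicator {x \<in> space M. 0 < max_birkhoff_sum g (Suc n) x} x * g x)"
proof -
  let ?m = "max_birkhoff_sum g (Suc n)"
  have m: "integrable M ?m" by (rule integrable_max_birkhoff_sum[OF g])
  have [measurable]: "?m \<in> borel_measurable M" "g \<in> borel_measurable M"
    using m g by auto
  have "0 = (LINT x|M. ?m x - ?m (T x))"
    using Bochner_Integration.integral_diff[OF m integrable_T[OF m]] integral_T[of ?m] m by auto
  also have "\<dots> \<le> (LINT x|M. indicator {x \<in> space M. 0 < ?m x} x * g x)"
  proof (rule integral_mono)
    show "integrable M (\<lambda>x. ?m x - ?m (T x))"
      by (rule Bochner_Integration.integrable_diff[OF m integrable_T[OF m]])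
    show "integrable M (\<lambda>x. indicator {x \<in> space M. 0 < ?m x} x * g x)"
      using integrable_real_mult_indicator[OF _ g, of "{x \<in> space M. 0 < ?m x}"]
      by (simp add: mult.commute del: max_birkhoff_sum.simps)
    fix x assume x: "x \<in> space M"
    show "?m x - ?m (T x) \<le> indicator {x \<in> space M. 0 < ?m x} x * g x"
    proof (cases "0 < ?m x")
      case True
      then have "?m x = g x + max_birkhoff_sum g n (T x)" by (simp add: max_def split: if_splits)
      with True x show ?thesis using max_birkhoff_sum_mono[of n "Suc n" g "T x"] by simp
    next
      case False
      then have "indicat_real {x \<in> space M. 0 < ?m x} x = 0" "?m x \<le> 0"
        by (simp_all add: indicator_def del: max_birkhoff_sum.simps)
      then show ?thesis using max_birkhoff_sum_nonneg[of g "Suc n" "T x"] by (simp only: mult_zero_left)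
    qed
  qed
  finally show ?thesis .
qed

text \<open>The set \<open>E\<close> of points with sums unbounded above is invariant. If it had
  measure one, the positivity sets of the maximal inequality would exhaust the space up to a null
  set and force \<integral>g \<ge> 0.\<close>

lemma AE_birkhoff_sum_bounded:
  fixes g :: "'a \<Rightarrow> real"
  assumes g: "integrable M g" and neg: "integral\<^sup>L M g < 0"
  shows "AE x in M. \<exists>c::nat. \<forall>N. (\<Sum>i<N. g ((T ^^ i) x)) \<le> c"
proof -
  have [measurable]: "g \<in> borel_measurable M" using g by auto
  define E where "E = {x \<in> space M. \<forall>c::nat. \<exists>N. (\<Sum>i<N. g ((T ^^ i) x)) > c}"
  have E: "E \<in> sets M" unfolding E_def by measurable
  have "T x \<in> E \<longleftrightarrow> x \<in> E" if x: "x \<in> space M" for x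
  proof
    assume TE: "T x \<in> E"
    show "x \<in> E" unfolding E_def
    proof (intro CollectI conjI allI x)
      fix c :: nat
      \<comment> \<open>Raising the threshold by a natural number that is at least
        \<open>\<bar>g x\<bar>\<close> pays for the first term, by which the two sums
        differ.\<close>
      obtain N where "(\<Sum>i<N. g ((T ^^ i) (T x))) > real (c + nat \<lceil>\<bar>g x\<bar>\<rceil>)"
        using TE unfolding E_def by blast
      moreover have "\<bar>g x\<bar> \<le> real (nat \<lceil>\<bar>g x\<bar>\<rceil>)" by linarith
      ultimately have "(\<Sum>i<Suc N. g ((T ^^ i) x)) > c" unfolding birkhoff_sum_Suc by linarith
      then show "\<exists>N. (\<Sum>i<N. g ((T ^^ i) x)) > c" by blast
    qed
  next
    assume xE: "x \<in> E"
    show "T x \<in> E" unfolding E_def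
    proof (intro CollectI conjI allI T_space x)
      fix c :: nat
      obtain N where N: "(\<Sum>i<N. g ((T ^^ i) x)) > real (c + nat \<lceil>\<bar>g x\<bar>\<rceil>)"
        using xE unfolding E_def by blast
      have "N \<noteq> 0"
      proof
        assume "N = 0"
        with N have "real (c + nat \<lceil>\<bar>g x\<bar>\<rceil>) < 0" by (simp only: lessThan_0 sum.empty)
        then show False using of_nat_0_le_iff not_less by blast
      qed
      then obtain N' where "N = Suc N'" using not0_implies_Suc by blast
      moreover have "\<bar>g x\<bar> \<le> real (nat \<lceil>\<bar>g x\<bar>\<rceil>)" by linarith
      ultimately have "(\<Sum>i<N'. g ((T ^^ i) (T x))) > c"
        using N by (simp only: birkhoff_sum_Suc)
      then show "\<exists>N. (\<Sum>i<N. g ((T ^^ i) (T x))) > c" by blast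
    qed
  qed
  then have "T -` E \<inter> space M = E" unfolding E_def by auto
  from T_ergodic[OF E this] have "prob E = 0"
  proof
    assume "prob E = 1"
    then have AE_E: "AE x in M. x \<in> E" using E by (simp add: prob_eq_1)
    let ?A = "\<lambda>n. {x \<in> space M. 0 < max_birkhoff_sum g (Suc n) x}"
    have [measurable]: "max_birkhoff_sum g n \<in> borel_measurable M" for n
      using integrable_max_birkhoff_sum[OF g] by blast
    have "(\<lambda>n. LINT x|M. indicator (?A n) x * g x) \<longlonglongrightarrow> integral\<^sup>L M g"
    proof (rule integral_dominated_convergence[where w = "\<lambda>x. norm (g x)"])
      show "AE x in M. (\<lambda>n. indicator (?A n) x * g x) \<longlonglongrightarrow> g x"
        using AE_E
      proof eventually_elim
        case (elim x)
        then obtain N where "real 0 < (\<Sum>i<N. g ((T ^^ i) x))" and x: "x \<in> space M"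
          unfolding E_def by blast
        then have N: "0 < (\<Sum>i<N. g ((T ^^ i) x))" by simp
        have "eventually (\<lambda>n. indicator (?A n) x * g x = g x) sequentially"
          using eventually_ge_at_top[of N]
        proof eventually_elim
          case (elim n)
          have "0 < max_birkhoff_sum g N x" using N birkhoff_sum_le_max[where g = g and N = N and x = x] by linarith
          also have "\<dots> \<le> max_birkhoff_sum g (Suc n) x" using elim by (intro max_birkhoff_sum_mono) simp
          finally show ?case using x by simp
        qed
        then show ?case by (rule tendsto_eventually)
      qed
      show "(\<lambda>x. indicator (?A n) x * g x) \<in> borel_measurable M" for n by measurable
      show "AE x in M. norm (indicator (?A n) x * g x) \<le> norm (g x)" for n
        by (rule AE_I2) (simp add: indicator_def del: max_birkhoff_sum.simps)
    qed (use g in auto)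
    then have "0 \<le> integral\<^sup>L M g"
      by (rule LIMSEQ_le_const) (use maximal_ergodic[OF g] in auto)
    with neg show ?thesis by simp
  qed
  then have "AE x in M. x \<notin> E" using E by (simp add: prob_eq_0)
  then show ?thesis
    using AE_space by eventually_elim (auto simp: E_def not_less)
qed

lemma AE_birkhoff_limsup:
  fixes g :: "'a \<Rightarrow> real"
  assumes g: "integrable M g" and e: "e > 0"
  shows "AE x in M. eventually (\<lambda>N. (\<Sum>i<N. g ((T ^^ i) x)) / N < integral\<^sup>L M g + e) sequentially"
proof -
  \<comment> \<open>Subtracting the constant makes the integral -e/2, which is negative; the other
    e/2 absorbs c/N.\<close>
  have "AE x in M. \<exists>c::nat. \<forall>N. (\<Sum>i<N. g ((T ^^ i) x) - integral\<^sup>L M g - e / 2) \<le> c"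
    by (rule AE_birkhoff_sum_bounded) (use g e prob_space in auto)
  then show ?thesis
  proof eventually_elim
    case (elim x)
    then obtain c :: nat where c: "\<And>N. (\<Sum>i<N. g ((T ^^ i) x) - integral\<^sup>L M g - e / 2) \<le> c" by blast
    have "eventually (\<lambda>N. real c / real N < e / 2) sequentially"
      using e by (intro order_tendstoD(2)[OF lim_const_over_n]) auto
    then show ?case using eventually_gt_at_top[of 0]
    proof eventually_elim
      case (elim N)
      have "(\<Sum>i<N. g ((T ^^ i) x)) \<le> c + N * (integral\<^sup>L M g + e / 2)"
        using c[of N] by (simp add: sum_subtractf algebra_simps)
      then have "(\<Sum>i<N. g ((T ^^ i) x)) / N \<le> (c + N * (integral\<^sup>L M g + e / 2)) / N"
        by (rule divide_right_mono) simp
      also have "\<dots> = c / N + (integral\<^sup>L M g + e / 2)"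
        using elim by (simp add: field_simps)
      finally show ?case using elim by linarith
    qed
  qed
qed

theorem birkhoff_real:
  fixes g :: "'a \<Rightarrow> real"
  assumes g: "integrable M g"
  shows "AE x in M. (\<lambda>N. (\<Sum>i<N. g ((T ^^ i) x)) / N) \<longlonglongrightarrow> integral\<^sup>L M g"
proof -
  have "AE x in M. \<forall>j. eventually (\<lambda>N. (\<Sum>i<N. g ((T ^^ i) x)) / N < integral\<^sup>L M g + 1 / Suc j) sequentially"
    unfolding AE_all_countable by (intro allI AE_birkhoff_limsup[OF g]) simp
  moreover have "AE x in M. \<forall>j. eventually (\<lambda>N. (\<Sum>i<N. - g ((T ^^ i) x)) / N < integral\<^sup>L M (\<lambda>x. - g x) + 1 / Suc j) sequentially"
    unfolding AE_all_countable by (intro allI AE_birkhoff_limsup) (use g in auto)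
  ultimately show ?thesis
  proof eventually_elim
    case (elim x)
    show ?case
    proof (rule LIMSEQ_I)
      fix r :: real assume "0 < r"
      then obtain j where j: "1 / Suc j < r" using nat_approx_posE by (metis of_nat_Suc)
      have "eventually (\<lambda>N. norm ((\<Sum>i<N. g ((T ^^ i) x)) / N - integral\<^sup>L M g) < r) sequentially"
        using elim(1)[rule_format, of j] elim(2)[rule_format, of j]
        by eventually_elim (use j in \<open>auto simp: sum_negf\<close>)
      then show "\<exists>no. \<forall>N\<ge>no. norm ((\<Sum>i<N. g ((T ^^ i) x)) / N - integral\<^sup>L M g) < r"
        unfolding eventually_sequentially .
    qed
  qed
qed

theorem birkhoff:
  fixes f :: "'a \<Rightarrow> complex"
  assumes f: "integrable M f"
  shows "AE x in M. (\<lambda>N. (\<Sum>n=1..N. f ((T ^^ n) x)) / N) \<longlonglongrightarrow> integral\<^sup>L M f"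
proof -
  \<comment> \<open>The averages here start at n = 1, those of \<open>birkhoff_real\<close> at i =
    0; composing with \<open>T\<close> absorbs the shift.\<close>
  let ?g = "\<lambda>x. f (T x)"
  have g: "integrable M ?g" by (rule integrable_T[OF f])
  have "integral\<^sup>L M ?g = integral\<^sup>L M f" using f by (intro integral_T) auto
  with g have "integral\<^sup>L M (\<lambda>x. Re (?g x)) = Re (integral\<^sup>L M f)" "integral\<^sup>L M (\<lambda>x. Im (?g x)) = Im (integral\<^sup>L M f)"
    by simp_all
  then have "AE x in M. (\<lambda>N. (\<Sum>i<N. Re (?g ((T ^^ i) x))) / N) \<longlonglongrightarrow> Re (integral\<^sup>L M f)"
    "AE x in M. (\<lambda>N. (\<Sum>i<N. Im (?g ((T ^^ i) x))) / N) \<longlonglongrightarrow> Im (integral\<^sup>L M f)"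
    using birkhoff_real[of "\<lambda>x. Re (?g x)"] birkhoff_real[of "\<lambda>x. Im (?g x)"] g by simp_all
  then show ?thesis
  proof eventually_elim
    case (elim x)
    have "(\<Sum>n=1..N. f ((T ^^ n) x)) = (\<Sum>i<N. ?g ((T ^^ i) x))" for N
      by (simp add: sum.atLeast1_atMost_eq)
    with elim show ?case
      unfolding tendsto_complex_iff by (simp add: Re_divide_of_nat Im_divide_of_nat)
  qed
qed

end

section \<open>Existence of the limits in the seminorms\<close>

text \<open>Unlike \<open>Linfty\<close> this records the bound, so that constants can be chosen
  uniformly over all functions with a given bound.\<close>

definition ae_bounded :: "'a measure \<Rightarrow> real \<Rightarrow> ('a \<Rightarrow> complex) \<Rightarrow> bool" where
  "ae_bounded M B f \<longleftrightarrow> f \<in> borel_measurable M \<and> (AE x in M. cmod (f x) \<le> B)"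

lemma borel_measurable_cnj [measurable]: "cnj \<in> borel_measurable borel"
  by (intro borel_measurable_continuous_onI continuous_intros)

lemma Linfty_iff_ae_bounded: "f \<in> Linfty M \<longleftrightarrow> (\<exists>B. ae_bounded M B f)"
  by (auto simp: Linfty_def ae_bounded_def)

lemma ae_bounded_mult:
  "ae_bounded M B f \<Longrightarrow> ae_bounded M C g \<Longrightarrow> ae_bounded M (B * C) (\<lambda>x. f x * g x)"
proof -
  assume f: "ae_bounded M B f" and g: "ae_bounded M C g"
  then have "AE x in M. cmod (f x) \<le> B" "AE x in M. cmod (g x) \<le> C"
    by (simp_all add: ae_bounded_def)
  then have "AE x in M. cmod (f x * g x) \<le> B * C"
  proof eventually_elim
    case (elim x)
    moreover have "0 \<le> B" using norm_ge_zero elim(1) by (rule order_trans)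
    ultimately show ?case by (simp add: norm_mult mult_mono)
  qed
  with f g show "ae_bounded M (B * C) (\<lambda>x. f x * g x)"
    by (auto simp: ae_bounded_def intro: borel_measurable_times)
qed

lemma ae_bounded_cnj: "ae_bounded M B f \<Longrightarrow> ae_bounded M B (\<lambda>x. cnj (f x))"
  unfolding ae_bounded_def by (auto intro: measurable_compose[OF _ borel_measurable_cnj])

lemma Linfty_mult: "f \<in> Linfty M \<Longrightarrow> g \<in> Linfty M \<Longrightarrow> (\<lambda>x. f x * g x) \<in> Linfty M"
  unfolding Linfty_iff_ae_bounded using ae_bounded_mult by blast

lemma Linfty_cnj: "f \<in> Linfty M \<Longrightarrow> (\<lambda>x. cnj (f x)) \<in> Linfty M"
  unfolding Linfty_iff_ae_bounded using ae_bounded_cnj by blast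

lemma cesaro_average_from_1:
  fixes k :: "nat \<Rightarrow> real"
  assumes b: "\<And>j. \<bar>k j\<bar> \<le> b" and lim: "(\<lambda>H. (\<Sum>j<H. k j) / H) \<longlonglongrightarrow> l"
  shows "(\<lambda>H. 1 / real H * (\<Sum>h=1..H. k h)) \<longlonglongrightarrow> l"
proof -
  have "(\<lambda>H. 1 / real H * (\<Sum>h=1..H. k h) - (\<Sum>j<H. k j) / H) \<longlonglongrightarrow> 0"
  proof (rule Lim_null_comparison)
    show "(\<lambda>H. 2 * b / real H) \<longlonglongrightarrow> 0" by (rule lim_const_over_n)
    have "\<bar>(\<Sum>h=1..H. k h) - (\<Sum>j<H. k j)\<bar> \<le> 2 * b" for H
      using norm_sum_shift_diff[of k b 1 H] b by (simp add: sum.atLeast1_atMost_eq)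
    then have "\<bar>(\<Sum>h=1..H. k h) - (\<Sum>j<H. k j)\<bar> / H \<le> 2 * b / H" for H
      by (intro divide_right_mono) auto
    then show "\<forall>\<^sub>F H in sequentially. norm (1 / real H * (\<Sum>h=1..H. k h) - (\<Sum>j<H. k j) / H) \<le> 2 * b / real H"
      by (simp add: diff_divide_distrib[symmetric] abs_divide)
  qed
  from tendsto_add[OF this lim] show ?thesis by simp
qed

context prob_space
begin

lemma ae_bounded_nonneg: "ae_bounded M B f \<Longrightarrow> 0 \<le> B"
proof -
  assume "ae_bounded M B f"
  then have "AE x in M. cmod (f x) \<le> B" by (simp add: ae_bounded_def)
  then have "AE x in M. 0 \<le> B"
    by eventually_elim (rule order_trans[OF norm_ge_zero])
  then show ?thesis by simp
qed

lemma integrable_ae_bounded: "ae_bounded M B f \<Longrightarrow> integrable M f"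
  unfolding ae_bounded_def by (intro integrable_const_bound) auto

lemma integrable_Linfty: "f \<in> Linfty M \<Longrightarrow> integrable M f"
  unfolding Linfty_iff_ae_bounded using integrable_ae_bounded by blast

lemma cmod_integral_le:
  assumes "ae_bounded M B f"
  shows "cmod (integral\<^sup>L M f) \<le> B"
proof -
  have "cmod (integral\<^sup>L M f) \<le> (LINT x|M. cmod (f x))"
    by (rule integral_norm_bound)
  also have "\<dots> \<le> (LINT x|M. B)"
    using assms integrable_ae_bounded[OF assms] unfolding ae_bounded_def
    by (intro integral_mono_AE) auto
  finally show ?thesis by (simp add: prob_space)
qed

text \<open>The quadratic form is the double integral of
  \<open>|\<Sum>i. c i * G i x * cnj (G i y)|\<^sup>2\<close> over \<open>x\<close> and \<open>y\<close>.\<close>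

lemma psd_square_gram:
  fixes G :: "nat \<Rightarrow> 'a \<Rightarrow> complex" and c :: "nat \<Rightarrow> real"
  assumes G: "\<And>i. G i \<in> Linfty M"
  shows "0 \<le> (\<Sum>i\<in>I. \<Sum>j\<in>I. c i * c j * (cmod (LINT x|M. G i x * cnj (G j x)))\<^sup>2)"
proof -
  define a where "a i j = (LINT x|M. G i x * cnj (G j x))" for i j
  have int: "integrable M (\<lambda>x. G i x * cnj (G j x))" for i j
    by (intro integrable_Linfty Linfty_mult Linfty_cnj G)
  define R where "R x = (LINT y|M. (cmod (\<Sum>i\<in>I. of_real (c i) * G i x * cnj (G i y)))\<^sup>2)" for x
  have R: "complex_of_real (R x) = (\<Sum>i\<in>I. \<Sum>j\<in>I. of_real (c i * c j) * cnj (a i j) * (G i x * cnj (G j x)))" for x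
  proof -
    have cnj_int: "integrable M (\<lambda>y. cnj (G i y * cnj (G j y)))" for i j
      using int by (simp del: complex_cnj_mult)
    have "complex_of_real (R x) = (LINT y|M. complex_of_real ((cmod (\<Sum>i\<in>I. of_real (c i) * G i x * cnj (G i y)))\<^sup>2))"
      unfolding R_def by (rule integral_complex_of_real[symmetric])
    also have "\<dots> = (LINT y|M. (\<Sum>i\<in>I. \<Sum>j\<in>I. of_real (c i * c j) * (G i x * cnj (G j x)) * cnj (G i y * cnj (G j y))))"
      by (simp only: complex_norm_square cnj_sum sum_product) (simp add: mult_ac)
    also have "\<dots> = (\<Sum>i\<in>I. \<Sum>j\<in>I. of_real (c i * c j) * (G i x * cnj (G j x)) * cnj (a i j))"
      using cnj_int by (simp add: a_def integral_cnj[symmetric] del: complex_cnj_mult integral_cnj)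
    finally show ?thesis by (simp only: mult_ac)
  qed
  have "complex_of_real (\<Sum>i\<in>I. \<Sum>j\<in>I. c i * c j * (cmod (a i j))\<^sup>2)
      = (\<Sum>i\<in>I. \<Sum>j\<in>I. of_real (c i * c j) * cnj (a i j) * a i j)"
    by (simp add: complex_norm_square mult_ac del: of_real_power)
  also have "\<dots> = (LINT x|M. of_real (R x))"
    unfolding R using int by (simp add: a_def)
  also have "\<dots> = of_real (integral\<^sup>L M R)" by (rule integral_complex_of_real)
  finally have "(\<Sum>i\<in>I. \<Sum>j\<in>I. c i * c j * (cmod (a i j))\<^sup>2) = integral\<^sup>L M R"
    unfolding of_real_eq_iff .
  moreover have "0 \<le> integral\<^sup>L M R"
    unfolding R_def by (intro Bochner_Integration.integral_nonneg) auto
  ultimately show ?thesis unfolding a_def by simp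
qed

end

context invertible_ergodic_system
begin

text \<open>\<open>hk_energy n\<close> plays the role of the seminorm of order \<open>n + 1\<close> raised to the power
  \<open>2 ^ (n + 1)\<close>; the recursion starts at order one, where the seminorm of an ergodic system is
  \<open>|\<integral>f|\<close>.\<close>

primrec hk_energy :: "nat \<Rightarrow> ('a \<Rightarrow> complex) \<Rightarrow> real" where
  "hk_energy 0 f = (cmod (integral\<^sup>L M f))\<^sup>2"
| "hk_energy (Suc n) f =
    lim (\<lambda>H. 1 / real H * (\<Sum>h=1..H. hk_energy n (\<lambda>x. f x * cnj (f ((T ^^ h) x)))))"

lemma ae_bounded_T_pow: "ae_bounded M B f \<Longrightarrow> ae_bounded M B (\<lambda>x. f ((T ^^ n) x))"
  unfolding ae_bounded_def
  using AE_T_pow[of "\<lambda>x. cmod (f x) \<le> B"] measurable_compose[OF T_pow_measurable] by blast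

lemma Linfty_T_pow: "f \<in> Linfty M \<Longrightarrow> (\<lambda>x. f ((T ^^ n) x)) \<in> Linfty M"
  unfolding Linfty_iff_ae_bounded using ae_bounded_T_pow by blast

lemma ae_bounded_derivative: "ae_bounded M B f \<Longrightarrow> ae_bounded M (B\<^sup>2) (\<lambda>x. f x * cnj (f ((T ^^ h) x)))"
  unfolding power2_eq_square
  by (intro ae_bounded_mult ae_bounded_cnj ae_bounded_T_pow)

lemma Linfty_derivative: "f \<in> Linfty M \<Longrightarrow> (\<lambda>x. f x * cnj (f ((T ^^ h) x))) \<in> Linfty M"
  by (intro Linfty_mult Linfty_cnj Linfty_T_pow)

lemma hk_energy_T: "f \<in> borel_measurable M \<Longrightarrow> hk_energy n (\<lambda>x. f (T x)) = hk_energy n f"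
proof (induction n arbitrary: f)
  case 0
  then show ?case using integral_T[of f] by simp
next
  case (Suc n)
  have "hk_energy n (\<lambda>x. f (T x) * cnj (f (T ((T ^^ h) x)))) = hk_energy n (\<lambda>x. f x * cnj (f ((T ^^ h) x)))" for h
  proof -
    have "(\<lambda>x. f x * cnj (f ((T ^^ h) x))) \<in> borel_measurable M"
      using Suc.prems by measurable
    from Suc.IH[OF this] show ?thesis by (simp add: funpow_swap1)
  qed
  then show ?case by (simp add: funpow_swap1)
qed

lemma hk_energy_cnj: "hk_energy n (\<lambda>x. cnj (f x)) = hk_energy n f"
proof (induction n arbitrary: f)
  case (Suc n)
  have "hk_energy n (\<lambda>x. cnj (f x) * f ((T ^^ h) x)) = hk_energy n (\<lambda>x. f x * cnj (f ((T ^^ h) x)))" for h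
    using Suc[of "\<lambda>x. f x * cnj (f ((T ^^ h) x))"] by simp
  then show ?case by simp
qed simp

definition hk_kernel :: "nat \<Rightarrow> ('a \<Rightarrow> complex) \<Rightarrow> nat \<Rightarrow> nat \<Rightarrow> real" where
  "hk_kernel n f i j = hk_energy n (\<lambda>x. f ((T ^^ i) x) * cnj (f ((T ^^ j) x)))"

text \<open>The induction invariant: the two conditions make \<open>hk_kernel n f\<close> bounded
  and positive semidefinite, which yields the limit that defines the next level.\<close>

definition hk_energy_regular :: "nat \<Rightarrow> bool" where
  "hk_energy_regular n \<longleftrightarrow>
    (\<forall>B f. ae_bounded M B f \<longrightarrow> 0 \<le> hk_energy n f \<and> hk_energy n f \<le> B ^ 2 ^ Suc n) \<and>
    (\<forall>F I (c :: nat \<Rightarrow> real). (\<forall>i. F i \<in> Linfty M) \<longrightarrow> finite (I :: nat set) \<longrightarrow>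
      0 \<le> (\<Sum>i\<in>I. \<Sum>j\<in>I. c i * c j * hk_energy n (\<lambda>x. F i x * cnj (F j x))))"

lemma hk_kernel_stationary_psd:
  assumes n: "hk_energy_regular n" and f: "ae_bounded M B f"
  shows "stationary_psd_kernel (hk_kernel n f) ((B\<^sup>2) ^ 2 ^ Suc n)"
proof
  have meas: "f \<in> borel_measurable M" using f by (simp add: ae_bounded_def)
  have fL: "f \<in> Linfty M" using f by (auto simp: Linfty_iff_ae_bounded)
  show "psd_kernel (hk_kernel n f)"
    unfolding psd_kernel_def hk_kernel_def
  proof (intro allI impI)
    fix I :: "nat set" and c :: "nat \<Rightarrow> real" assume "finite I"
    moreover have "\<forall>i. (\<lambda>x. f ((T ^^ i) x)) \<in> Linfty M" using Linfty_T_pow[OF fL] by blast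
    ultimately show "0 \<le> (\<Sum>i\<in>I. \<Sum>j\<in>I. c i * c j * hk_energy n (\<lambda>x. f ((T ^^ i) x) * cnj (f ((T ^^ j) x))))"
      using n[unfolded hk_energy_regular_def, THEN conjunct2, rule_format, of "\<lambda>i x. f ((T ^^ i) x)" I c] by simp
  qed
  fix i j
  show "hk_kernel n f i j = hk_kernel n f j i"
    using hk_energy_cnj[of n "\<lambda>x. f ((T ^^ i) x) * cnj (f ((T ^^ j) x))"]
    by (simp add: hk_kernel_def mult.commute)
  have "(\<lambda>x. f ((T ^^ i) x) * cnj (f ((T ^^ j) x))) \<in> borel_measurable M"
    using meas by measurable
  from hk_energy_T[OF this, of n]
  show "hk_kernel n f (Suc i) (Suc j) = hk_kernel n f i j"
    by (simp add: hk_kernel_def funpow_swap1)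
  have "ae_bounded M (B\<^sup>2) (\<lambda>x. f ((T ^^ i) x) * cnj (f ((T ^^ j) x)))"
    unfolding power2_eq_square by (intro ae_bounded_mult ae_bounded_cnj ae_bounded_T_pow f)
  then show "\<bar>hk_kernel n f i j\<bar> \<le> (B\<^sup>2) ^ 2 ^ Suc n"
    using n unfolding hk_kernel_def hk_energy_regular_def by (metis abs_of_nonneg)
qed

text \<open>Row 0 of \<open>hk_kernel n f\<close> is the averaged sequence, so the value of
  \<open>lim\<close> is the \<open>lim_value\<close> of that kernel, and the third claim is the
  Fejer bound.\<close>

lemma hk_energy_Suc_limit:
  assumes n: "hk_energy_regular n" and f: "f \<in> Linfty M"
  shows "(\<lambda>H. 1 / real H * (\<Sum>h=1..H. hk_energy n (\<lambda>x. f x * cnj (f ((T ^^ h) x))))) \<longlonglongrightarrow> hk_energy (Suc n) f"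
    and "(\<lambda>H. (\<Sum>h<H. hk_energy n (\<lambda>x. f x * cnj (f ((T ^^ h) x)))) / H) \<longlonglongrightarrow> hk_energy (Suc n) f"
    and "N > 0 \<Longrightarrow> hk_energy (Suc n) f \<le> 2 * (\<Sum>h<N. hk_energy n (\<lambda>x. f x * cnj (f ((T ^^ h) x)))) / N"
proof -
  obtain B where B: "ae_bounded M B f" using f by (auto simp: Linfty_iff_ae_bounded)
  interpret stationary_psd_kernel "hk_kernel n f" "(B\<^sup>2) ^ 2 ^ Suc n"
    by (rule hk_kernel_stationary_psd[OF n B])
  have K: "hk_kernel n f 0 h = hk_energy n (\<lambda>x. f x * cnj (f ((T ^^ h) x)))" for h
    by (simp add: hk_kernel_def)
  have 1: "(\<lambda>H. (\<Sum>h<H. hk_energy n (\<lambda>x. f x * cnj (f ((T ^^ h) x)))) / H) \<longlonglongrightarrow> lim_value"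
    using row_average_tendsto unfolding K .
  have 2: "(\<lambda>H. 1 / real H * (\<Sum>h=1..H. hk_energy n (\<lambda>x. f x * cnj (f ((T ^^ h) x))))) \<longlonglongrightarrow> lim_value"
    using cesaro_average_from_1[OF bounded row_average_tendsto] unfolding K .
  have 3: "hk_energy (Suc n) f = lim_value" using 2 by (simp add: limI)
  show "(\<lambda>H. 1 / real H * (\<Sum>h=1..H. hk_energy n (\<lambda>x. f x * cnj (f ((T ^^ h) x))))) \<longlonglongrightarrow> hk_energy (Suc n) f"
    "(\<lambda>H. (\<Sum>h<H. hk_energy n (\<lambda>x. f x * cnj (f ((T ^^ h) x)))) / H) \<longlonglongrightarrow> hk_energy (Suc n) f"
    using 1 2 unfolding 3 by auto
  have "0 \<le> hk_kernel n f 0 j" for j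
    using n ae_bounded_derivative[OF B, of j] unfolding K hk_energy_regular_def by blast
  from lim_value_le_row_average[OF this, of N]
  show "N > 0 \<Longrightarrow> hk_energy (Suc n) f \<le> 2 * (\<Sum>h<N. hk_energy n (\<lambda>x. f x * cnj (f ((T ^^ h) x)))) / N"
    unfolding 3 K .
qed

text \<open>The derivative of \<open>F i * cnj (F j)\<close> along \<open>h\<close> is
  \<open>G h i * cnj (G h j)\<close>. The Gram shape thus survives the recursion, and positivity
  passes to averages and limits.\<close>

lemma hk_energy_regular: "hk_energy_regular n"
proof (induction n)
  case 0
  show ?case unfolding hk_energy_regular_def
    using psd_square_gram cmod_integral_le by (auto intro!: power_mono)
next
  case (Suc n)
  have "0 \<le> hk_energy (Suc n) f \<and> hk_energy (Suc n) f \<le> B ^ 2 ^ Suc (Suc n)" if f: "ae_bounded M B f" for B f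
  proof -
    have b: "0 \<le> hk_energy n (\<lambda>x. f x * cnj (f ((T ^^ h) x))) \<and> hk_energy n (\<lambda>x. f x * cnj (f ((T ^^ h) x))) \<le> (B\<^sup>2) ^ 2 ^ Suc n" for h
      using Suc ae_bounded_derivative[OF f] unfolding hk_energy_regular_def by blast
    have "f \<in> Linfty M" using f by (auto simp: Linfty_iff_ae_bounded)
    note lim = hk_energy_Suc_limit(2)[OF Suc this]
    have "0 \<le> (\<Sum>h<H. hk_energy n (\<lambda>x. f x * cnj (f ((T ^^ h) x)))) / H" for H :: nat
      using b by (intro divide_nonneg_nonneg sum_nonneg) auto
    then have 1: "0 \<le> hk_energy (Suc n) f" by (intro LIMSEQ_le_const[OF lim]) blast
    have "(\<Sum>h<H. hk_energy n (\<lambda>x. f x * cnj (f ((T ^^ h) x)))) / H \<le> (B\<^sup>2) ^ 2 ^ Suc n" if "H > 0" for H :: nat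
    proof -
      have "(\<Sum>h<H. hk_energy n (\<lambda>x. f x * cnj (f ((T ^^ h) x)))) \<le> (\<Sum>h<H. (B\<^sup>2) ^ 2 ^ Suc n)"
        using b by (intro sum_mono) auto
      then show ?thesis using that by (simp add: field_simps)
    qed
    then have "hk_energy (Suc n) f \<le> (B\<^sup>2) ^ 2 ^ Suc n"
      by (intro LIMSEQ_le_const2[OF lim]) (auto intro!: exI[of _ 1])
    with 1 show ?thesis by (simp flip: power_mult)
  qed
  moreover have "0 \<le> (\<Sum>i\<in>I. \<Sum>j\<in>I. c i * c j * hk_energy (Suc n) (\<lambda>x. F i x * cnj (F j x)))"
    if F: "\<forall>i. F i \<in> Linfty M" and I: "finite I" for F and I :: "nat set" and c :: "nat \<Rightarrow> real"
  proof -
    define G where "G h i x = F i x * cnj (F i ((T ^^ h) x))" for h i x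
    have lim: "(\<lambda>H. 1 / real H * (\<Sum>h=1..H. hk_energy n (\<lambda>x. G h i x * cnj (G h j x))))
        \<longlonglongrightarrow> hk_energy (Suc n) (\<lambda>x. F i x * cnj (F j x))" for i j
    proof -
      have "(\<lambda>x. F i x * cnj (F j x)) \<in> Linfty M" using F by (intro Linfty_mult Linfty_cnj) auto
      from hk_energy_Suc_limit(1)[OF Suc this] show ?thesis by (simp add: G_def mult_ac)
    qed
    have "0 \<le> (\<Sum>i\<in>I. \<Sum>j\<in>I. c i * c j * (1 / real H * (\<Sum>h=1..H. hk_energy n (\<lambda>x. G h i x * cnj (G h j x)))))" for H
    proof -
      have "0 \<le> (\<Sum>i\<in>I. \<Sum>j\<in>I. c i * c j * hk_energy n (\<lambda>x. G h i x * cnj (G h j x)))" for h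
      proof -
        have "G h i \<in> Linfty M" for i unfolding G_def[abs_def] using F Linfty_derivative by blast
        then show ?thesis using Suc I unfolding hk_energy_regular_def by blast
      qed
      then have "0 \<le> 1 / real H * (\<Sum>h=1..H. \<Sum>i\<in>I. \<Sum>j\<in>I. c i * c j * hk_energy n (\<lambda>x. G h i x * cnj (G h j x)))"
        by (intro mult_nonneg_nonneg sum_nonneg[of "{1..H}"]) auto
      also have "(\<Sum>h=1..H. \<Sum>i\<in>I. \<Sum>j\<in>I. c i * c j * hk_energy n (\<lambda>x. G h i x * cnj (G h j x)))
          = (\<Sum>i\<in>I. \<Sum>h=1..H. \<Sum>j\<in>I. c i * c j * hk_energy n (\<lambda>x. G h i x * cnj (G h j x)))"
        by (rule sum.swap)
      also have "\<dots> = (\<Sum>i\<in>I. \<Sum>j\<in>I. \<Sum>h=1..H. c i * c j * hk_energy n (\<lambda>x. G h i x * cnj (G h j x)))"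
        by (intro sum.cong refl sum.swap)
      finally show ?thesis by (simp add: sum_distrib_left mult_ac)
    qed
    then show ?thesis
      by (intro LIMSEQ_le_const[OF tendsto_sum[OF tendsto_sum[OF tendsto_mult_left[OF lim]]]]) blast
  qed
  ultimately show ?case unfolding hk_energy_regular_def by blast
qed

lemmas hk_energy_tendsto = hk_energy_Suc_limit(2)[OF hk_energy_regular]

lemma hk_energy_nonneg: "f \<in> Linfty M \<Longrightarrow> 0 \<le> hk_energy n f"
  using hk_energy_regular[of n] unfolding hk_energy_regular_def Linfty_iff_ae_bounded by blast

lemma hk_energy_le: "ae_bounded M B f \<Longrightarrow> hk_energy n f \<le> B ^ 2 ^ Suc n"
  using hk_energy_regular[of n] unfolding hk_energy_regular_def by blast

lemma hk_energy_Suc_le: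
  assumes f: "ae_bounded M B f" and N: "N > 0"
  shows "hk_energy (Suc n) f
    \<le> 2 * (1 / N * (\<Sum>h=1..N. hk_energy n (\<lambda>x. f x * cnj (f ((T ^^ h) x))))) + 2 * (B\<^sup>2) ^ 2 ^ Suc n / N"
proof -
  let ?e = "\<lambda>h. hk_energy n (\<lambda>x. f x * cnj (f ((T ^^ h) x)))"
  have fL: "f \<in> Linfty M" using f by (auto simp: Linfty_iff_ae_bounded)
  have "(\<Sum>h<N. ?e h) \<le> (\<Sum>h<Suc N. ?e h)"
    using hk_energy_nonneg[OF Linfty_derivative[OF fL]] by simp
  \<comment> \<open>The averages in the seminorms begin at h = 1; the term for h = 0 is estimated by
    the uniform bound and becomes the error of order 1/N.\<close>
  also have "\<dots> = ?e 0 + (\<Sum>h=1..N. ?e h)"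
    by (simp only: sum.lessThan_Suc_shift sum.atLeast1_atMost_eq[of ?e] One_nat_def)
  also have "\<dots> \<le> (B\<^sup>2) ^ 2 ^ Suc n + (\<Sum>h=1..N. ?e h)"
    by (intro add_right_mono hk_energy_le ae_bounded_derivative f)
  finally have "2 * (\<Sum>h<N. ?e h) / N \<le> 2 * ((B\<^sup>2) ^ 2 ^ Suc n + (\<Sum>h=1..N. ?e h)) / N"
    by (intro divide_right_mono) auto
  also have "\<dots> = 2 * (1 / N * (\<Sum>h=1..N. ?e h)) + 2 * (B\<^sup>2) ^ 2 ^ Suc n / N"
    using N by (simp add: field_simps)
  finally show ?thesis
    using hk_energy_Suc_limit(3)[OF hk_energy_regular[of n] fL N] by linarith
qed

text \<open>Nonnegativity of the energies lets the power undo the root inside the average.\<close>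

lemma hk_seminorm_eq: "f \<in> Linfty M \<Longrightarrow> hk_seminorm M T (Suc (Suc n)) f = root (2 ^ (n + 2)) (hk_energy (Suc n) f)"
proof (induction n arbitrary: f)
  case (Suc n)
  have "hk_seminorm M T (Suc (Suc n)) (\<lambda>x. f x * cnj (f ((T ^^ h) x))) ^ 2 ^ (n + 2)
      = hk_energy (Suc n) (\<lambda>x. f x * cnj (f ((T ^^ h) x)))" for h
    using Suc.IH[OF Linfty_derivative[OF Suc.prems, of h]] hk_energy_nonneg[OF Linfty_derivative[OF Suc.prems, of h]]
    by (simp add: real_root_pow_pos2 del: hk_seminorm.simps hk_energy.simps)
  then show ?case
    unfolding hk_seminorm.simps(4) hk_energy.simps(2)[of "Suc n"]
    by (simp only: add_Suc) (simp add: numeral_eq_Suc)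
qed simp

lemma hk_seminorm_eq_0_iff:
  assumes "f \<in> Linfty M"
  shows "hk_seminorm M T (Suc (Suc n)) f = 0 \<longleftrightarrow> hk_energy (Suc n) f = 0"
  unfolding hk_seminorm_eq[OF assms] by (simp add: real_root_eq_0_iff)

end

section \<open>Cube products and Wiener--Wintner averages\<close>

lemma PiE_atLeast1_Suc:
  "({1..Suc m} \<rightarrow>\<^sub>E S) = (\<lambda>(y, g). g(Suc m := y)) ` (S \<times> ({1..m} \<rightarrow>\<^sub>E S))"
proof -
  have "{1..Suc m} = insert (Suc m) {1..m}" by auto
  then show ?thesis by (simp add: PiE_insert_eq)
qed

lemma inj_on_PiE_upd:
  "inj_on (\<lambda>(y, g). g(Suc m := y)) (S \<times> ({1..m} \<rightarrow>\<^sub>E S))"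
proof (rule inj_onI, clarify)
  fix y g y' g'
  assume g: "g \<in> {1..m} \<rightarrow>\<^sub>E S" and g': "g' \<in> {1..m} \<rightarrow>\<^sub>E S" and eq: "g(Suc m := y) = g'(Suc m := y')"
  have "y = y'" using fun_cong[OF eq, of "Suc m"] by simp
  moreover have "g = g'"
  proof
    fix i show "g i = g' i"
    proof (cases "i = Suc m")
      case True
      then show ?thesis using PiE_arb[OF g, of i] PiE_arb[OF g', of i] by simp
    next
      case False
      then show ?thesis using fun_cong[OF eq, of i] by simp
    qed
  qed
  ultimately show "y = y' \<and> g = g'" by simp
qed

lemma sum_PiE_Suc:
  fixes F :: "(nat \<Rightarrow> nat) \<Rightarrow> 'b::comm_monoid_add"
  shows "(\<Sum>h\<in>{1..Suc m} \<rightarrow>\<^sub>E S. F h) = (\<Sum>y\<in>S. \<Sum>g\<in>{1..m} \<rightarrow>\<^sub>E S. F (g(Suc m := y)))"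
  unfolding PiE_atLeast1_Suc sum.reindex[OF inj_on_PiE_upd] sum.cartesian_product
  by (simp add: case_prod_unfold comp_def)

lemma prod_PiE_Suc:
  fixes F :: "(nat \<Rightarrow> nat) \<Rightarrow> 'b::comm_monoid_mult"
  shows "(\<Prod>h\<in>{1..Suc m} \<rightarrow>\<^sub>E S. F h) = (\<Prod>y\<in>S. \<Prod>g\<in>{1..m} \<rightarrow>\<^sub>E S. F (g(Suc m := y)))"
  unfolding PiE_atLeast1_Suc prod.reindex[OF inj_on_PiE_upd] prod.cartesian_product
  by (simp add: case_prod_unfold comp_def)



lemma funpow_cnj_mult: "(cnj ^^ s) (a * b) = (cnj ^^ s) a * (cnj ^^ s) b"
  by (induction s) simp_all

lemma funpow_cnj_cnj: "(cnj ^^ s) (cnj z) = cnj ((cnj ^^ s) z)"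
  by (induction s) simp_all

lemma cube_product_0 [simp]: "cube_product T 0 f h x = f x"
  by (simp add: cube_product_def cube_def)

lemma cube_product_cong: "(\<And>j. j \<in> {1..m} \<Longrightarrow> h j = h' j) \<Longrightarrow> cube_product T m f h x = cube_product T m f h' x"
  unfolding cube_product_def by (intro prod.cong refl arg_cong2[of _ _ _ _ "\<lambda>p y. (cnj ^^ p) (f ((T ^^ y) x))"] sum.cong) auto

text \<open>Split the cube by its last coordinate: the value 1 there adds one conjugation and the
  shift \<open>h (Suc m)\<close>.\<close>

lemma cube_product_Suc:
  "cube_product T (Suc m) f h x
    = cube_product T m f h x * cnj (cube_product T m f h ((T ^^ h (Suc m)) x))"
proof -
  have *: "(\<Sum>j = 1..Suc m. F ((g(Suc m := y)) j) j) = (\<Sum>j = 1..m. F (g j) j) + F y (Suc m)"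
    for g :: "nat \<Rightarrow> nat" and y and F :: "nat \<Rightarrow> nat \<Rightarrow> nat"
    by (auto simp: sum.cl_ivl_Suc intro!: sum.cong)
  show ?thesis
    unfolding cube_product_def cube_def prod_PiE_Suc
      *[of "\<lambda>a j. a"] *[of "\<lambda>a j. h j * a"]
    by (simp add: funpow_add funpow_cnj_cnj)
qed

lemma cube_product_upd:
  "cube_product T (Suc m) f (g(Suc m := l)) x
    = cube_product T m f g x * cnj (cube_product T m f g ((T ^^ l) x))"
proof -
  have "cube_product T m f (g(Suc m := l)) y = cube_product T m f g y" for y
    by (rule cube_product_cong) simp
  then show ?thesis by (simp add: cube_product_Suc)
qed

lemma cube_product_derivative:
  "cube_product T m (\<lambda>x. f x * cnj (f ((T ^^ l) x))) g x
    = cube_product T m f g x * cnj (cube_product T m f g ((T ^^ l) x))"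
proof -
  have "(T ^^ l) ((T ^^ p) x) = (T ^^ p) ((T ^^ l) x)" for p
    by (metis add.commute comp_apply funpow_add)
  then show ?thesis
    unfolding cube_product_def by (simp add: funpow_cnj_mult funpow_cnj_cnj prod.distrib)
qed

text \<open>Derivatives commute with cube products, so the last cube shift can be moved into the
  function. This is how a cube dimension is traded for a derivative.\<close>

lemma cube_product_upd_derivative:
  "cube_product T (Suc m) f (g(Suc m := l)) x = cube_product T m (\<lambda>x. f x * cnj (f ((T ^^ l) x))) g x"
  unfolding cube_product_upd cube_product_derivative ..

lemma cmod_cube_product_le:
  assumes "\<And>n. cmod (f ((T ^^ n) x)) \<le> B"
  shows "cmod (cube_product T m f h x) \<le> B ^ 2 ^ m"
  using assms
proof (induction m arbitrary: x)
  case 0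
  from "0"[of 0] show ?case by simp
next
  case (Suc m)
  have "cmod (f ((T ^^ n) ((T ^^ h (Suc m)) x))) \<le> B" for n
    using Suc.prems[of "n + h (Suc m)"] by (simp add: funpow_add)
  from Suc.IH[OF Suc.prems] Suc.IH[OF this]
  have "cmod (cube_product T (Suc m) f h x) \<le> B ^ 2 ^ m * B ^ 2 ^ m"
    unfolding cube_product_Suc norm_mult complex_mod_cnj
    by (intro mult_mono) (auto intro: order_trans[OF norm_ge_zero])
  then show ?case by (simp add: mult_2 power_add)
qed

section \<open>Averages with a supremum over the frequency\<close>

definition sup_exponential_average :: "(nat \<Rightarrow> complex) \<Rightarrow> nat \<Rightarrow> real" where
  "sup_exponential_average u N = (SUP t::real.
    (cmod ((1 / of_nat N) * (\<Sum>n = 1..N. exp (2 * of_real pi * \<i> * of_nat n * of_real t) * u n)))\<^sup>2)"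

lemma cmod_phase: "cmod (exp (2 * of_real pi * \<i> * of_nat n * of_real t)) = 1"
  by (metis (no_types, opaque_lifting) mult.assoc mult.commute norm_exp_i_times of_real_mult of_real_numeral of_real_of_nat_eq)

lemma phase_eq_cis: "exp (2 * of_real pi * \<i> * of_nat n * of_real t) = cis (2 * pi * (real n * t))"
  by (simp add: cis_conv_exp mult_ac)

context
  fixes u :: "nat \<Rightarrow> complex" and B :: real
  assumes B: "\<And>n. cmod (u n) \<le> B"
begin

text \<open>Bounds the values uniformly in \<open>t\<close>; without an upper bound the real
  \<open>SUP\<close> would carry no information.\<close>

lemma exponential_average_le:
  "(cmod ((1 / of_nat N) * (\<Sum>n = 1..N. exp (2 * of_real pi * \<i> * of_nat n * of_real t) * u n)))\<^sup>2 \<le> B\<^sup>2"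
proof (rule power_mono)
  have "cmod (\<Sum>n = 1..N. exp (2 * of_real pi * \<i> * of_nat n * of_real t) * u n) \<le> (\<Sum>n = 1..N. B)"
    by (intro order_trans[OF norm_sum] sum_mono) (simp only: norm_mult cmod_phase mult_1_left B)
  then show "cmod ((1 / of_nat N) * (\<Sum>n = 1..N. exp (2 * of_real pi * \<i> * of_nat n * of_real t) * u n)) \<le> B"
    using order_trans[OF norm_ge_zero B[of 0]] by (cases "N = 0") (simp_all add: norm_mult norm_divide field_simps)
qed simp

lemma exponential_average_le_sup:
  "(cmod ((1 / of_nat N) * (\<Sum>n = 1..N. exp (2 * of_real pi * \<i> * of_nat n * of_real t) * u n)))\<^sup>2
    \<le> sup_exponential_average u N"
  unfolding sup_exponential_average_def
  by (intro cSUP_upper bdd_aboveI2[of _ _ "B\<^sup>2"] exponential_average_le) simp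

lemma sup_exponential_average_nonneg: "0 \<le> sup_exponential_average u N"
  using exponential_average_le_sup[of N 0] zero_le_power2 order_trans by blast

text \<open>Modulation by \<open>t\<close> multiplies the correlation at distance \<open>d\<close>
  by a unimodular constant, so the van der Corput bound is independent of \<open>t\<close> and
  passes to the supremum.\<close>

lemma sup_exponential_average_le_van_der_corput:
  assumes N: "N > 0" and L: "L > 0"
  shows "sup_exponential_average u N
    \<le> 4 / L * (\<Sum>d<L. cmod (\<Sum>n=1..N. u n * cnj (u (n + d))) / N) + 12 * (real L)\<^sup>2 * B\<^sup>2 / N"
  unfolding sup_exponential_average_def
proof (rule cSUP_least)
  fix t :: real
  define v where "v n = cis (2 * pi * (real n * t)) * u n" for n
  have "v n * cnj (v (n + d)) = cis (- (2 * pi * (real d * t))) * (u n * cnj (u (n + d)))" for n d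
  proof -
    have "v n * cnj (v (n + d))
        = (cis (2 * pi * (real n * t)) * cis (- (2 * pi * (real (n + d) * t)))) * (u n * cnj (u (n + d)))"
      by (simp add: v_def cis_cnj mult_ac)
    also have "cis (2 * pi * (real n * t)) * cis (- (2 * pi * (real (n + d) * t))) = cis (- (2 * pi * (real d * t)))"
      unfolding cis_mult by (rule arg_cong[of _ _ cis]) (simp add: algebra_simps)
    finally show ?thesis .
  qed
  then have "cmod (\<Sum>n=1..N. v n * cnj (v (n + d))) = cmod (\<Sum>n=1..N. u n * cnj (u (n + d)))" for d
    by (simp add: sum_distrib_left[symmetric] norm_mult)
  moreover have "cmod (v n) \<le> B" for n using B by (simp add: v_def norm_mult)
  ultimately have "(cmod (\<Sum>n=1..N. v n) / N)\<^sup>2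
      \<le> 4 / L * (\<Sum>d<L. cmod (\<Sum>n=1..N. u n * cnj (u (n + d))) / N) + 12 * (real L)\<^sup>2 * B\<^sup>2 / N"
    using van_der_corput_inequality[of v B N L] N L by simp
  then show "(cmod ((1 / of_nat N) * (\<Sum>n = 1..N. exp (2 * of_real pi * \<i> * of_nat n * of_real t) * u n)))\<^sup>2
      \<le> 4 / L * (\<Sum>d<L. cmod (\<Sum>n=1..N. u n * cnj (u (n + d))) / N) + 12 * (real L)\<^sup>2 * B\<^sup>2 / N"
    unfolding phase_eq_cis v_def[symmetric] by (simp add: norm_mult norm_divide)
qed simp

lemma mean_correlation_square_le:
  assumes N: "N > 0"
  shows "1 / real N * (\<Sum>h=1..N. (cmod (\<Sum>n=1..N. u n * cnj (u (n + h))) / N)\<^sup>2)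
    \<le> 2 * B\<^sup>2 * sup_exponential_average u N"
proof -
  have "(cmod (\<Sum>n=1..N. cis (2 * pi * (real n * t)) * u n))\<^sup>2 \<le> (real N)\<^sup>2 * sup_exponential_average u N" for t
    using exponential_average_le_sup[of N t] N unfolding phase_eq_cis
    by (simp add: norm_mult norm_divide power_mult_distrib power_divide field_simps)
  \<comment> \<open>Of the three factors \<open>N\<close> in the denominator one belongs to the mean
    over \<open>h\<close> and two to the squared mean over \<open>n\<close>.\<close>
  from correlation_square_sum_le[OF B N this]
  have "(\<Sum>h=1..N. (cmod (\<Sum>n=1..N. u n * cnj (u (n + h))))\<^sup>2) / (real N)^3
      \<le> 2 * real N * B\<^sup>2 * ((real N)\<^sup>2 * sup_exponential_average u N) / (real N)^3"
    by (rule divide_right_mono) simp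
  also have "\<dots> = 2 * B\<^sup>2 * sup_exponential_average u N"
    using N by (simp add: power2_eq_square power3_eq_cube)
  finally show ?thesis
    by (simp add: power_divide sum_divide_distrib[symmetric] power2_eq_square power3_eq_cube)
qed

end

definition cube_wiener_wintner :: "('a \<Rightarrow> 'a) \<Rightarrow> nat \<Rightarrow> ('a \<Rightarrow> complex) \<Rightarrow> nat \<Rightarrow> 'a \<Rightarrow> real" where
  "cube_wiener_wintner T m f N x = 1 / real N ^ m *
    (\<Sum>h\<in>{1..m} \<rightarrow>\<^sub>E {1..N}. sup_exponential_average (\<lambda>n. cube_product T m f h ((T ^^ n) x)) N)"

lemma cmod_cube_product_orbit_le:
  assumes "\<And>n. cmod (f ((T ^^ n) x)) \<le> B"
  shows "cmod (cube_product T m f h ((T ^^ n) x)) \<le> B ^ 2 ^ m"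
proof (rule cmod_cube_product_le)
  fix j show "cmod (f ((T ^^ j) ((T ^^ n) x))) \<le> B"
    using assms[of "j + n"] by (simp add: funpow_add)
qed

lemma cube_wiener_wintner_nonneg:
  assumes "\<And>n. cmod (f ((T ^^ n) x)) \<le> B"
  shows "0 \<le> cube_wiener_wintner T m f N x"
  unfolding cube_wiener_wintner_def
  by (intro mult_nonneg_nonneg sum_nonneg       sup_exponential_average_nonneg[OF cmod_cube_product_orbit_le[where f = f and T = T and x = x and B = B, OF assms]]) simp

section \<open>Lowering the cube dimension\<close>

text \<open>Cauchy-Schwarz for the mean over \<open>d\<close>, after (a + b)^2 \<le> 2 a^2 + 2 b^2;
  the constant is 32 = 2 * 4^2.\<close>

lemma square_le_of_le_mean:
  fixes e :: "nat \<Rightarrow> real"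
  assumes a: "0 \<le> a" "a \<le> 4 / L * (\<Sum>d<L. e d) + R"
  shows "a\<^sup>2 \<le> 32 / L * (\<Sum>d<L. (e d)\<^sup>2) + 2 * R\<^sup>2"
proof -
  have "(\<Sum>d<L. e d)\<^sup>2 \<le> (\<Sum>d<L. (e d)\<^sup>2) * L"
    using sum_squared_le_sum_of_squares[of e "{..<L}"] by (simp add: mult.commute)
  then have "(4 / L)\<^sup>2 * (\<Sum>d<L. e d)\<^sup>2 \<le> (4 / L)\<^sup>2 * ((\<Sum>d<L. (e d)\<^sup>2) * L)"
    by (rule mult_left_mono) simp
  then have 1: "(4 / L * (\<Sum>d<L. e d))\<^sup>2 \<le> 16 / L * (\<Sum>d<L. (e d)\<^sup>2)"
    by (cases "L = 0") (simp_all add: power_mult_distrib power2_eq_square field_simps)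
  have "a\<^sup>2 \<le> (4 / L * (\<Sum>d<L. e d) + R)\<^sup>2" using a by (intro power_mono)
  also have "\<dots> \<le> 2 * (4 / L * (\<Sum>d<L. e d))\<^sup>2 + 2 * R\<^sup>2"
    unfolding power2_sum using sum_squares_bound[of "4 / L * (\<Sum>d<L. e d)" R] by linarith
  finally show ?thesis using 1 by simp
qed

lemma cube_wiener_wintner_0: "cube_wiener_wintner T 0 f N x = sup_exponential_average (\<lambda>n. f ((T ^^ n) x)) N"
  by (simp add: cube_wiener_wintner_def)

lemma cube_wiener_wintner_0_square_le:
  assumes B: "\<And>n. cmod (f ((T ^^ n) x)) \<le> B" and N: "N > 0" and L: "L > 0"
  shows "(cube_wiener_wintner T 0 f N x)\<^sup>2
    \<le> 32 / L * (\<Sum>d<L. (cmod ((\<Sum>n=1..N. f ((T ^^ n) x) * cnj (f ((T ^^ d) ((T ^^ n) x)))) / N))\<^sup>2)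
      + 288 * (real L)^4 * B^4 / (real N)\<^sup>2"
proof -
  have T: "(T ^^ (n + d)) x = (T ^^ d) ((T ^^ n) x)" for n d
    by (subst add.commute) (simp add: funpow_add)
  have "cube_wiener_wintner T 0 f N x \<le>
      4 / L * (\<Sum>d<L. cmod ((\<Sum>n=1..N. f ((T ^^ n) x) * cnj (f ((T ^^ d) ((T ^^ n) x)))) / N))
      + 12 * (real L)\<^sup>2 * B\<^sup>2 / N"
    unfolding cube_wiener_wintner_0
    using sup_exponential_average_le_van_der_corput[where u = "\<lambda>n. f ((T ^^ n) x)", OF B N L]
    unfolding T by (simp add: norm_divide)
  \<comment> \<open>Squaring the van der Corput error gives 288 = 2 * 12^2.\<close>
  from square_le_of_le_mean[OF cube_wiener_wintner_nonneg[where f = f and T = T, OF B] this]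
  show ?thesis by (simp add: power_mult_distrib power_divide flip: power_mult)
qed

text \<open>Van der Corput removes the supremum over \<open>t\<close>. The correlation at distance
  \<open>d\<close> of a cube product with last shift \<open>j\<close> is the correlation at distance
  \<open>j\<close> of the smaller cube product of the derivative \<open>fd d\<close>. Cauchy-Schwarz
  and Parseval over \<open>j\<close> then restore a supremum, in dimension \<open>p\<close>.\<close>

lemma cube_wiener_wintner_Suc_square_le:
  fixes p :: nat
  assumes B: "\<And>n. cmod (f ((T ^^ n) x)) \<le> B" and N: "N > 0" and L: "L > 0"
  defines "D \<equiv> B ^ 2 ^ Suc p"
  shows "(cube_wiener_wintner T (Suc p) f N x)\<^sup>2
    \<le> 64 * D\<^sup>2 * ((\<Sum>d<L. cube_wiener_wintner T p (\<lambda>x. f x * cnj (f ((T ^^ d) x))) N x) / L)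
      + 288 * (real L)^4 * D^4 / (real N)\<^sup>2"
proof -
  have B0: "0 \<le> B" using B[of 0] norm_ge_zero order_trans by blast
  let ?P = "{1..p} \<rightarrow>\<^sub>E {1..N}"
  define fd where "fd d x = f x * cnj (f ((T ^^ d) x))" for d x
  define v where "v d g n = cube_product T p (fd d) g ((T ^^ n) x)" for d g n
  have fdB: "cmod (fd d ((T ^^ n) x)) \<le> B\<^sup>2" for d n
    using B[of n] B[of "d + n"] B0 unfolding fd_def power2_eq_square
    by (simp add: norm_mult mult_mono funpow_add)
  have vD: "cmod (v d g n) \<le> D" for d g n
    using cmod_cube_product_orbit_le[of "fd d" T x "B\<^sup>2" p g n, OF fdB]
    unfolding v_def D_def by (simp flip: power_mult)
  define e where "e d j g = cmod (\<Sum>n=1..N. v d g n * cnj (v d g (n + j))) / N" for d j g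
  have T: "(T ^^ (n + d)) x = (T ^^ d) ((T ^^ n) x)" for n d
    by (subst add.commute) (simp add: funpow_add)
  have ua: "sup_exponential_average (\<lambda>n. cube_product T (Suc p) f (g(Suc p := j)) ((T ^^ n) x)) N
      \<le> 4 / L * (\<Sum>d<L. e d j g) + 12 * (real L)\<^sup>2 * D\<^sup>2 / N" for g j
  proof -
    \<comment> \<open>Both sides consist of the same four factors, at times n, n + j, n + d and n +
      d + j, an expression symmetric in \<open>d\<close> and \<open>j\<close>.\<close>
    have "cube_product T (Suc p) f (g(Suc p := j)) ((T ^^ n) x)
        * cnj (cube_product T (Suc p) f (g(Suc p := j)) ((T ^^ (n + d)) x)) = v d g n * cnj (v d g (n + j))" for n d
    proof -
      have "(T ^^ d) ((T ^^ (n + j)) x) = (T ^^ j) ((T ^^ (n + d)) x)"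
        by (metis T add.assoc add.commute)
      then show ?thesis
        unfolding cube_product_upd v_def fd_def cube_product_derivative
        by (simp add: T[symmetric] mult_ac)
    qed
    then show ?thesis
      using sup_exponential_average_le_van_der_corput[of "\<lambda>n. cube_product T (Suc p) f (g(Suc p := j)) ((T ^^ n) x)" D,
          OF _ N L] cmod_cube_product_orbit_le[of f T x B "Suc p", OF B]
      unfolding e_def D_def by simp
  qed
  define E where "E d = 1 / real N ^ Suc p * (\<Sum>j=1..N. \<Sum>g\<in>?P. e d j g)" for d
  have card: "real N ^ Suc p = (\<Sum>j=1..N. \<Sum>g\<in>?P. 1)" by (simp add: card_PiE)
  have ww: "cube_wiener_wintner T (Suc p) f N x \<le> 4 / L * (\<Sum>d<L. E d) + 12 * (real L)\<^sup>2 * D\<^sup>2 / N"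
  proof -
    let ?R = "12 * (real L)\<^sup>2 * D\<^sup>2 / N"
    have "cube_wiener_wintner T (Suc p) f N x = 1 / real N ^ Suc p * (\<Sum>j=1..N. \<Sum>g\<in>?P.
        sup_exponential_average (\<lambda>n. cube_product T (Suc p) f (g(Suc p := j)) ((T ^^ n) x)) N)"
      unfolding cube_wiener_wintner_def sum_PiE_Suc ..
    also have "\<dots> \<le> 1 / real N ^ Suc p * (\<Sum>j=1..N. \<Sum>g\<in>?P. 4 / L * (\<Sum>d<L. e d j g) + ?R)"
      by (intro mult_left_mono sum_mono ua) simp
    also have "(\<Sum>j=1..N. \<Sum>g\<in>?P. 4 / L * (\<Sum>d<L. e d j g) + ?R)
        = 4 / L * (\<Sum>j=1..N. \<Sum>g\<in>?P. \<Sum>d<L. e d j g) + real N ^ Suc p * ?R"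
      unfolding card by (simp add: sum.distrib sum_distrib_left)
    also have "(\<Sum>j=1..N. \<Sum>g\<in>?P. \<Sum>d<L. e d j g) = (\<Sum>d<L. \<Sum>j=1..N. \<Sum>g\<in>?P. e d j g)"
      by (subst sum.swap[of _ "{..<L}"]) (intro sum.cong refl sum.swap)
    also have "1 / real N ^ Suc p * (4 / L * (\<Sum>d<L. \<Sum>j=1..N. \<Sum>g\<in>?P. e d j g) + real N ^ Suc p * ?R)
        = 4 / L * (\<Sum>d<L. E d) + ?R"
      using N unfolding E_def by (simp add: sum_distrib_left[symmetric] sum_divide_distrib[symmetric] distrib_left mult_ac)
    finally show ?thesis .
  qed
  have EE: "(E d)\<^sup>2 \<le> 2 * D\<^sup>2 * cube_wiener_wintner T p (fd d) N x" for d
  proof -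
    have "(\<Sum>j=1..N. \<Sum>g\<in>?P. e d j g)\<^sup>2 \<le> real N ^ Suc p * (\<Sum>j=1..N. \<Sum>g\<in>?P. (e d j g)\<^sup>2)"
      using sum_squared_le_sum_of_squares[of "\<lambda>(j, g). e d j g" "{1..N} \<times> ?P"]
      by (simp add: sum.cartesian_product card_cartesian_product card_PiE case_prod_unfold mult.commute finite_PiE)
    then have "(E d)\<^sup>2 \<le> (1 / real N ^ Suc p)\<^sup>2 * (real N ^ Suc p * (\<Sum>j=1..N. \<Sum>g\<in>?P. (e d j g)\<^sup>2))"
      unfolding E_def power_mult_distrib by (rule mult_left_mono) simp
    also have "\<dots> = 1 / real N ^ p * (\<Sum>g\<in>?P. 1 / real N * (\<Sum>j=1..N. (e d j g)\<^sup>2))"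
      using N by (subst sum.swap) (simp add: sum_distrib_left[symmetric] power2_eq_square sum_divide_distrib[symmetric])
    also have "\<dots> \<le> 1 / real N ^ p * (\<Sum>g\<in>?P. 2 * D\<^sup>2 * sup_exponential_average (v d g) N)"
      unfolding e_def by (intro mult_left_mono sum_mono mean_correlation_square_le N vD) simp
    also have "\<dots> = 2 * D\<^sup>2 * cube_wiener_wintner T p (fd d) N x"
      unfolding cube_wiener_wintner_def v_def by (simp add: sum_distrib_left[symmetric])
    finally show ?thesis .
  qed
  have "(cube_wiener_wintner T (Suc p) f N x)\<^sup>2 \<le> 32 / L * (\<Sum>d<L. (E d)\<^sup>2) + 2 * (12 * (real L)\<^sup>2 * D\<^sup>2 / N)\<^sup>2"
    by (rule square_le_of_le_mean[OF cube_wiener_wintner_nonneg[where f = f and T = T, OF B] ww])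
  also have "\<dots> \<le> 32 / L * (\<Sum>d<L. 2 * D\<^sup>2 * cube_wiener_wintner T p (fd d) N x) + 2 * (12 * (real L)\<^sup>2 * D\<^sup>2 / N)\<^sup>2"
    by (intro add_right_mono mult_left_mono sum_mono EE) simp
  finally show ?thesis
    unfolding fd_def by (simp add: power_mult_distrib power_divide sum_distrib_left[symmetric] flip: power_mult)
qed

lemma power_mean_le:
  fixes a :: "nat \<Rightarrow> real"
  assumes a: "\<And>d. d < L \<Longrightarrow> 0 \<le> a d" and L: "L > 0"
  shows "((\<Sum>d<L. a d) / L) ^ q \<le> (\<Sum>d<L. a d ^ q) / L"
proof -
  have "((\<Sum>d<L. a d) / L) ^ q = (\<Sum>d<L. (1 / L) *\<^sub>R a d) ^ q"
    by (simp add: sum_divide_distrib)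
  also have "\<dots> \<le> (\<Sum>d<L. (1 / L) * a d ^ q)"
  proof (rule convex_on_sum[where C = "{0..}"])
    show "convex_on {0..} (\<lambda>x::real. x ^ q)"
    proof (cases "even q")
      case True
      then show ?thesis using convex_on_subset[OF convex_power_even[OF True]] by auto
    qed (rule convex_power_odd)
  qed (use a L in auto)
  finally show ?thesis by (simp add: sum_divide_distrib)
qed

section \<open>Pointwise control by the seminorms\<close>

lemma lim_const_over_square: "(\<lambda>N. c / (real N)\<^sup>2) \<longlonglongrightarrow> 0"
  using tendsto_mult[OF lim_const_over_n[of c] lim_const_over_n[of 1]] by (simp add: power2_eq_square)

context invertible_ergodic_system
begin

lemma AE_ae_bounded_orbit:
  "ae_bounded M B f \<Longrightarrow> AE x in M. \<forall>n. cmod (f ((T ^^ n) x)) \<le> B"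
  unfolding ae_bounded_def using AE_all_T_pow by blast

text \<open>The ergodic theorem turns the orbit correlation for each \<open>d\<close> into an
  integral. \<open>L\<close> is fixed before \<open>N\<close> grows, so that the mean over d < L is
  already close to its limit \<open>hk_energy 1 f\<close>.\<close>

lemma cube_wiener_wintner_limsup_0:
  assumes f: "ae_bounded M B f"
  shows "AE x in M. \<forall>e>0. eventually (\<lambda>N. (cube_wiener_wintner T 0 f N x)\<^sup>2 \<le> 32 * hk_energy 1 f + e) sequentially"
proof -
  have fL: "f \<in> Linfty M" using f by (auto simp: Linfty_iff_ae_bounded)
  have "AE x in M. \<forall>d. (\<lambda>N. (\<Sum>n=1..N. f ((T ^^ n) x) * cnj (f ((T ^^ d) ((T ^^ n) x)))) / N)
      \<longlonglongrightarrow> (LINT x|M. f x * cnj (f ((T ^^ d) x)))"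
    unfolding AE_all_countable
    using birkhoff[OF integrable_Linfty[OF Linfty_derivative[OF fL]]] by blast
  then show ?thesis using AE_ae_bounded_orbit[OF f]
  proof eventually_elim
    case (elim x)
    show ?case
    proof (intro allI impI)
      fix e :: real assume e: "e > 0"
      have "eventually (\<lambda>L. (\<Sum>d<L. hk_energy 0 (\<lambda>x. f x * cnj (f ((T ^^ d) x)))) / L < hk_energy 1 f + e / 32 \<and> L > 0) sequentially"
        using e hk_energy_tendsto[OF fL, of 0]
        by (intro eventually_conj eventually_gt_at_top order_tendstoD(2)[where y = "hk_energy 1 f"]) auto
      then obtain L :: nat where L: "L > 0"
        "(\<Sum>d<L. hk_energy 0 (\<lambda>x. f x * cnj (f ((T ^^ d) x)))) / L < hk_energy 1 f + e / 32"
        using eventually_happens'[OF sequentially_bot] by blast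
      let ?S = "\<lambda>N. 32 / L * (\<Sum>d<L. (cmod ((\<Sum>n=1..N. f ((T ^^ n) x) * cnj (f ((T ^^ d) ((T ^^ n) x)))) / N))\<^sup>2)
        + 288 * (real L)^4 * B^4 / (real N)\<^sup>2"
      have "(\<lambda>N. 288 * (real L)^4 * B^4 / (real N)\<^sup>2) \<longlonglongrightarrow> 0" by (rule lim_const_over_square)
      then have "?S \<longlonglongrightarrow> 32 / L * (\<Sum>d<L. hk_energy 0 (\<lambda>x. f x * cnj (f ((T ^^ d) x)))) + 0"
        unfolding hk_energy.simps using elim(1) by (intro tendsto_intros) auto
      moreover have "32 / L * (\<Sum>d<L. hk_energy 0 (\<lambda>x. f x * cnj (f ((T ^^ d) x)))) + 0 < 32 * hk_energy 1 f + e"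
        using L(2) by simp
      ultimately have "eventually (\<lambda>N. ?S N < 32 * hk_energy 1 f + e) sequentially"
        by (rule order_tendstoD(2))
      then show "eventually (\<lambda>N. (cube_wiener_wintner T 0 f N x)\<^sup>2 \<le> 32 * hk_energy 1 f + e) sequentially"
        using eventually_gt_at_top[of 0]
      proof eventually_elim
        case (elim N)
        have "(cube_wiener_wintner T 0 f N x)\<^sup>2 \<le> ?S N"
          using \<open>\<forall>n. cmod (f ((T ^^ n) x)) \<le> B\<close> elim(2) L(1) by (intro cube_wiener_wintner_0_square_le) auto
        with elim(1) show ?case by linarith
      qed
    qed
  qed
qed

lemma add_power_le:
  fixes x y :: real
  assumes "0 \<le> x" "0 \<le> y"
  shows "(x + y) ^ q \<le> 2 ^ q * (x ^ q + y ^ q)"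
proof -
  have "(x + y) ^ q \<le> (2 * max x y) ^ q" using assms by (intro power_mono) auto
  also have "\<dots> \<le> 2 ^ q * (x ^ q + y ^ q)"
    using assms by (auto simp: power_mult_distrib max_def)
  finally show ?thesis .
qed

text \<open>Van der Corput with a fixed number \<open>L\<close> of differences trades one cube dimension for
  multiplicative derivatives of \<open>f\<close> along fixed shifts, so that the pointwise ergodic theorem
  is only ever applied to countably many functions.\<close>

lemma cube_wiener_wintner_limsup:
  "0 \<le> B \<Longrightarrow> \<exists>C\<ge>0. \<forall>f. ae_bounded M B f \<longrightarrow> (AE x in M. \<forall>e>0. eventually
    (\<lambda>N. cube_wiener_wintner T m f N x ^ 2 ^ Suc m \<le> C * hk_energy (Suc m) f + e) sequentially)"
proof (induction m arbitrary: B)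
  case 0
  show ?case using cube_wiener_wintner_limsup_0 by (intro exI[of _ 32]) simp
next
  case (Suc p)
  define q :: nat where "q = 2 ^ Suc p"
  have q: "q > 0" "2 ^ Suc (Suc p) = 2 * q" by (simp_all add: q_def)
  obtain C where C: "C \<ge> 0" "\<And>f. ae_bounded M (B\<^sup>2) f \<Longrightarrow> (AE x in M. \<forall>e>0. eventually
      (\<lambda>N. cube_wiener_wintner T p f N x ^ q \<le> C * hk_energy (Suc p) f + e) sequentially)"
    using Suc.IH[of "B\<^sup>2"] unfolding q_def by auto
  define D where "D = B ^ 2 ^ Suc p"
  \<comment> \<open>The factor \<open>2 ^ q\<close> comes from \<open>add_power_le\<close>, the
    other one from the recursive inequality raised to the power \<open>q\<close>.\<close>
  define A where "A = 2 ^ q * (64 * D\<^sup>2) ^ q"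
  have A: "A \<ge> 0" by (simp add: A_def)
  show ?case
  proof (intro exI[of _ "A * C"] conjI allI impI)
    show "0 \<le> A * C" using A C(1) by simp
    fix f assume f: "ae_bounded M B f"
    have fL: "f \<in> Linfty M" using f by (auto simp: Linfty_iff_ae_bounded)
    define fd where "fd d x = f x * cnj (f ((T ^^ d) x))" for d x
    have "ae_bounded M (B\<^sup>2) (fd d)" for d
      unfolding fd_def[abs_def] by (rule ae_bounded_derivative[OF f])
    then have "AE x in M. \<forall>d. \<forall>e>0. eventually
        (\<lambda>N. cube_wiener_wintner T p (fd d) N x ^ q \<le> C * hk_energy (Suc p) (fd d) + e) sequentially"
      unfolding AE_all_countable using C(2) by blast
    then show "AE x in M. \<forall>e>0. eventually
        (\<lambda>N. cube_wiener_wintner T (Suc p) f N x ^ 2 ^ Suc (Suc p) \<le> A * C * hk_energy (Suc (Suc p)) f + e) sequentially"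
      using AE_ae_bounded_orbit[OF f]
    proof eventually_elim
      case (elim x)
      have B: "cmod (f ((T ^^ n) x)) \<le> B" for n using elim(2) by blast
      have fdB: "cmod (fd d ((T ^^ n) x)) \<le> B\<^sup>2" for d n
        using B[of n] B[of "d + n"] \<open>0 \<le> B\<close> unfolding fd_def power2_eq_square
        by (simp add: norm_mult mult_mono funpow_add)
      show ?case
      proof (intro allI impI)
        fix e :: real assume e: "e > 0"
        have "(\<lambda>L. A * C * ((\<Sum>d<L. hk_energy (Suc p) (fd d)) / L)) \<longlonglongrightarrow> A * C * hk_energy (Suc (Suc p)) f"
          unfolding fd_def by (intro tendsto_intros hk_energy_tendsto[OF fL])
        then have "eventually (\<lambda>L. A * C * ((\<Sum>d<L. hk_energy (Suc p) (fd d)) / L) < A * C * hk_energy (Suc (Suc p)) f + e / 3 \<and> L > 0) sequentially"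
          using e by (intro eventually_conj eventually_gt_at_top order_tendstoD(2)) auto
        then obtain L :: nat where L: "L > 0"
          "A * C * ((\<Sum>d<L. hk_energy (Suc p) (fd d)) / L) < A * C * hk_energy (Suc (Suc p)) f + e / 3"
          using eventually_happens'[OF sequentially_bot] by blast
        \<comment> \<open>\<open>A + 1\<close> in place of \<open>A\<close> keeps the denominator
          positive when \<open>A = 0\<close>.\<close>
        define e' where "e' = e / (3 * (A + 1))"
        have e': "e' > 0" "A * e' \<le> e / 3"
          using e A by (auto simp: e'_def field_simps)
        have 1: "eventually (\<lambda>N. \<forall>d\<in>{..<L}. cube_wiener_wintner T p (fd d) N x ^ q \<le> C * hk_energy (Suc p) (fd d) + e') sequentially"
          using elim(1) e' by (intro eventually_ball_finite) auto
        define R where "R N = 288 * (real L)^4 * D^4 / (real N)\<^sup>2" for N :: nat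
        have "R \<longlonglongrightarrow> 0" unfolding R_def by (rule lim_const_over_square)
        then have "(\<lambda>N. 2 ^ q * R N ^ q) \<longlonglongrightarrow> 2 ^ q * 0 ^ q" by (intro tendsto_intros)
        then have 2: "eventually (\<lambda>N. 2 ^ q * R N ^ q < e / 3) sequentially"
          by (rule order_tendstoD(2)) (use e q(1) in \<open>simp add: zero_power\<close>)
        show "eventually (\<lambda>N. cube_wiener_wintner T (Suc p) f N x ^ 2 ^ Suc (Suc p)
            \<le> A * C * hk_energy (Suc (Suc p)) f + e) sequentially"
          using 1 2 eventually_gt_at_top[of 0]
        proof eventually_elim
          case (elim N)
          let ?w = "\<lambda>d. cube_wiener_wintner T p (fd d) N x"
          have w0: "0 \<le> ?w d" for d
            by (rule cube_wiener_wintner_nonneg[where f = "fd d" and T = T and x = x, OF fdB])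
          have "cube_wiener_wintner T (Suc p) f N x ^ 2 ^ Suc (Suc p) = ((cube_wiener_wintner T (Suc p) f N x)\<^sup>2) ^ q"
            unfolding q(2) by (simp add: power_mult)
          also have "\<dots> \<le> (64 * D\<^sup>2 * ((\<Sum>d<L. ?w d) / L) + R N) ^ q"
            unfolding D_def R_def fd_def
            by (intro power_mono cube_wiener_wintner_Suc_square_le B elim(3) L(1)) simp
          also have "\<dots> \<le> 2 ^ q * ((64 * D\<^sup>2 * ((\<Sum>d<L. ?w d) / L)) ^ q + R N ^ q)"
            using w0 by (intro add_power_le mult_nonneg_nonneg divide_nonneg_nonneg sum_nonneg) (auto simp: R_def)
          also have "\<dots> = A * ((\<Sum>d<L. ?w d) / L) ^ q + 2 ^ q * R N ^ q"
            unfolding power_mult_distrib[of "64 * D\<^sup>2"] by (simp only: A_def distrib_left mult.assoc)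
          also have "((\<Sum>d<L. ?w d) / L) ^ q \<le> (\<Sum>d<L. ?w d ^ q) / L"
            using w0 L(1) by (intro power_mean_le)
          also have "(\<Sum>d<L. ?w d ^ q) / L \<le> (\<Sum>d<L. C * hk_energy (Suc p) (fd d) + e') / L"
            using elim(1) by (intro divide_right_mono sum_mono) auto
          also have "(\<Sum>d<L. C * hk_energy (Suc p) (fd d) + e') / L = C * ((\<Sum>d<L. hk_energy (Suc p) (fd d)) / L) + e'"
            using L(1) by (simp add: sum.distrib sum_distrib_left[symmetric] field_simps)
          also have "A * (C * ((\<Sum>d<L. hk_energy (Suc p) (fd d)) / L) + e') + 2 ^ q * R N ^ q
              \<le> A * C * hk_energy (Suc (Suc p)) f + e"
            using L(2) e'(2) elim(2) by (simp add: distrib_left mult.assoc)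
          finally show ?case using A by (simp add: mult_left_mono)
        qed
      qed
    qed
  qed
qed

lemma cube_wiener_wintner_tendsto_0:
  assumes f: "f \<in> Linfty M" and "hk_energy (Suc m) f = 0"
  shows "AE x in M. (\<lambda>N. cube_wiener_wintner T m f N x) \<longlonglongrightarrow> 0"
proof -
  obtain B where B: "ae_bounded M B f" using f by (auto simp: Linfty_iff_ae_bounded)
  obtain C where "AE x in M. \<forall>e>0. eventually
      (\<lambda>N. cube_wiener_wintner T m f N x ^ 2 ^ Suc m \<le> C * hk_energy (Suc m) f + e) sequentially"
    using cube_wiener_wintner_limsup[OF ae_bounded_nonneg[OF B]] B by blast
  then show ?thesis using AE_ae_bounded_orbit[OF B]
  proof eventually_elim
    case (elim x)
    have nonneg: "0 \<le> cube_wiener_wintner T m f N x" for N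
      using elim(2) by (intro cube_wiener_wintner_nonneg) blast
    show ?case
    proof (rule order_tendstoI)
      fix a :: real assume "a < 0"
      then show "eventually (\<lambda>N. a < cube_wiener_wintner T m f N x) sequentially"
        by (intro always_eventually allI less_le_trans[OF _ nonneg])
    next
      fix a :: real assume a: "0 < a"
      \<comment> \<open>As the energy is zero only the tolerance is left; it is chosen as a power of
        a/2 so that the root can be extracted by monotonicity.\<close>
      have "eventually (\<lambda>N. cube_wiener_wintner T m f N x ^ 2 ^ Suc m \<le> (a / 2) ^ 2 ^ Suc m) sequentially"
        using elim(1)[rule_format, of "(a / 2) ^ 2 ^ Suc m"] a assms(2) by simp
      then show "eventually (\<lambda>N. cube_wiener_wintner T m f N x < a) sequentially"
      proof eventually_elim
        case (elim N)
        then have "cube_wiener_wintner T m f N x \<le> a / 2"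
          using nonneg[of N] a by (subst (asm) power_mono_iff) auto
        then show ?case using a by linarith
      qed
    qed
  qed
qed

section \<open>From vanishing averages to vanishing energy\<close>

lemma ae_bounded_cube_product: "ae_bounded M B f \<Longrightarrow> ae_bounded M (B ^ 2 ^ m) (cube_product T m f h)"
proof (induction m)
  case (Suc m)
  have "ae_bounded M (B ^ 2 ^ m * B ^ 2 ^ m) (\<lambda>x. cube_product T m f h x * cnj (cube_product T m f h ((T ^^ h (Suc m)) x)))"
    by (intro ae_bounded_mult ae_bounded_cnj ae_bounded_T_pow Suc)
  then show ?case by (simp add: cube_product_Suc[abs_def] mult_2 power_add)
qed (simp add: cube_product_0[abs_def])

text \<open>A simultaneous average over cubes controls the iterated limit from above, one coordinate at a time,
  because the Fejer averages of a positive definite sequence lie above their limit.\<close>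

lemma hk_energy_le_cube_average:
  "\<exists>K. \<forall>f N. ae_bounded M B f \<longrightarrow> N > 0 \<longrightarrow> hk_energy (n + r) f / 2 ^ r
    \<le> 1 / real N ^ r * (\<Sum>h\<in>{1..r} \<rightarrow>\<^sub>E {1..N}. hk_energy n (cube_product T r f h)) + K / N"
proof (induction r arbitrary: B)
  case 0
  show ?case by (intro exI[of _ 0]) (simp add: cube_product_0[abs_def])
next
  case (Suc r)
  obtain K where K: "\<And>f N. ae_bounded M (B\<^sup>2) f \<Longrightarrow> N > 0 \<Longrightarrow> hk_energy (n + r) f / 2 ^ r
      \<le> 1 / real N ^ r * (\<Sum>h\<in>{1..r} \<rightarrow>\<^sub>E {1..N}. hk_energy n (cube_product T r f h)) + K / N"
    using Suc[of "B\<^sup>2"] by blast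
  \<comment> \<open>The second summand is the error term of \<open>hk_energy_Suc_le\<close> after
    division by \<open>2 ^ Suc r\<close>.\<close>
  define K' where "K' = K + (B\<^sup>2) ^ 2 ^ Suc (n + r) / 2 ^ r"
  show ?case
  proof (intro exI[of _ K'] allI impI)
    fix f and N :: nat assume f: "ae_bounded M B f" and N: "N > 0"
    let ?fd = "\<lambda>d x. f x * cnj (f ((T ^^ d) x))"
    have "hk_energy (n + Suc r) f / 2 ^ Suc r
        \<le> (2 * (1 / N * (\<Sum>d=1..N. hk_energy (n + r) (?fd d))) + 2 * (B\<^sup>2) ^ 2 ^ Suc (n + r) / N) / 2 ^ Suc r"
      using hk_energy_Suc_le[OF f N, of "n + r"] by (intro divide_right_mono) simp_all
    also have "\<dots> = 1 / N * (\<Sum>d=1..N. hk_energy (n + r) (?fd d) / 2 ^ r) + (B\<^sup>2) ^ 2 ^ Suc (n + r) / 2 ^ r / N"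
      by (simp add: sum_divide_distrib[symmetric] add_divide_distrib mult.commute)
    also have "\<dots> \<le> 1 / N * (\<Sum>d=1..N. 1 / real N ^ r * (\<Sum>h\<in>{1..r} \<rightarrow>\<^sub>E {1..N}. hk_energy n (cube_product T r (?fd d) h)) + K / N)
        + (B\<^sup>2) ^ 2 ^ Suc (n + r) / 2 ^ r / N"
      using N by (intro add_right_mono mult_left_mono sum_mono K ae_bounded_derivative f) auto
    also have "\<dots> = 1 / real N ^ Suc r * (\<Sum>d=1..N. \<Sum>h\<in>{1..r} \<rightarrow>\<^sub>E {1..N}. hk_energy n (cube_product T r (?fd d) h)) + K' / N"
      using N by (simp add: sum.distrib sum_divide_distrib[symmetric] K'_def add_divide_distrib distrib_left)
    also have "(\<Sum>d=1..N. \<Sum>h\<in>{1..r} \<rightarrow>\<^sub>E {1..N}. hk_energy n (cube_product T r (?fd d) h))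
        = (\<Sum>h\<in>{1..Suc r} \<rightarrow>\<^sub>E {1..N}. hk_energy n (cube_product T (Suc r) f h))"
      unfolding sum_PiE_Suc cube_product_upd_derivative[abs_def] ..
    finally show "hk_energy (n + Suc r) f / 2 ^ Suc r
        \<le> 1 / real N ^ Suc r * (\<Sum>h\<in>{1..Suc r} \<rightarrow>\<^sub>E {1..N}. hk_energy n (cube_product T (Suc r) f h)) + K' / N" .
  qed
qed

text \<open>Passing from \<open>g\<close> to its Birkhoff mean does not change the integral, and
  nonnegativity of the variance gives the inequality between the squared mean and the mean square.
  The other two claims prepare dominated convergence.\<close>

lemma hk_energy_0_le_mean_square:
  assumes g: "ae_bounded M B g" and N: "N > 0"
  shows "hk_energy 0 g \<le> (LINT x|M. (cmod (\<Sum>n=1..N. g ((T ^^ n) x)) / N)\<^sup>2)"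
    and "integrable M (\<lambda>x. (cmod (\<Sum>n=1..N. g ((T ^^ n) x)) / N)\<^sup>2)"
    and "AE x in M. (cmod (\<Sum>n=1..N. g ((T ^^ n) x)) / N)\<^sup>2 \<le> B\<^sup>2"
proof -
  have [measurable]: "g \<in> borel_measurable M" using g by (simp add: ae_bounded_def)
  define G where "G x = cmod (\<Sum>n=1..N. g ((T ^^ n) x)) / N" for x
  have [measurable]: "G \<in> borel_measurable M" unfolding G_def[abs_def] by measurable
  have G: "AE x in M. \<bar>G x\<bar> \<le> B"
    using AE_ae_bounded_orbit[OF g]
  proof eventually_elim
    case (elim x)
    then have "cmod (\<Sum>n=1..N. g ((T ^^ n) x)) \<le> (\<Sum>n=1..N. B)"
      by (intro order_trans[OF norm_sum] sum_mono) auto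
    then show ?case using N by (simp add: G_def field_simps)
  qed
  then have G2: "AE x in M. (G x)\<^sup>2 \<le> B\<^sup>2"
    by eventually_elim (use abs_le_square_iff ae_bounded_nonneg[OF g] in fastforce)
  then show "AE x in M. (cmod (\<Sum>n=1..N. g ((T ^^ n) x)) / N)\<^sup>2 \<le> B\<^sup>2" by (simp add: G_def)
  have iG: "integrable M G" using G by (intro integrable_const_bound[where B = B]) auto
  have iG2: "integrable M (\<lambda>x. (G x)\<^sup>2)" using G2 by (intro integrable_const_bound[where B = "B\<^sup>2"]) auto
  then show "integrable M (\<lambda>x. (cmod (\<Sum>n=1..N. g ((T ^^ n) x)) / N)\<^sup>2)" by (simp add: G_def)
  have ig: "integrable M (\<lambda>x. g ((T ^^ n) x))" for n
    using integrable_ae_bounded[OF ae_bounded_T_pow[OF g]] .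
  have "integral\<^sup>L M g = (LINT x|M. (\<Sum>n=1..N. g ((T ^^ n) x)) / N)"
    using N ig integral_T_pow[of g] by simp
  then have "cmod (integral\<^sup>L M g) \<le> integral\<^sup>L M G"
    using integral_norm_bound[of M "\<lambda>x. (\<Sum>n=1..N. g ((T ^^ n) x)) / N"]
    by (simp add: G_def[abs_def] norm_divide)
  then have "(cmod (integral\<^sup>L M g))\<^sup>2 \<le> (integral\<^sup>L M G)\<^sup>2" by (intro power_mono) auto
  also have "\<dots> \<le> (LINT x|M. (G x)\<^sup>2)"
    using variance_eq[OF iG iG2] variance_positive[of G] by simp
  finally show "hk_energy 0 g \<le> (LINT x|M. (cmod (\<Sum>n=1..N. g ((T ^^ n) x)) / N)\<^sup>2)"
    by (simp add: G_def)
qed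

text \<open>Parseval over the last shift bounds the mean squares \<open>V\<close>, for cube products
  one dimension higher, by the averages that tend to 0. Dominated convergence passes to the
  integrals, which dominate a multiple of the energy up to an error of order 1/N.\<close>

lemma hk_energy_eq_0_if_cube_wiener_wintner:
  assumes f: "f \<in> Linfty M" and lim: "AE x in M. (\<lambda>N. cube_wiener_wintner T m f N x) \<longlonglongrightarrow> 0"
  shows "hk_energy (Suc m) f = 0"
proof -
  obtain B where B: "ae_bounded M B f" using f by (auto simp: Linfty_iff_ae_bounded)
  define D where "D = B ^ 2 ^ m"
  let ?P = "\<lambda>N::nat. {1..Suc m} \<rightarrow>\<^sub>E {1..N}"
  define Q where "Q N h x = (cmod (\<Sum>n=1..N. cube_product T (Suc m) f h ((T ^^ n) x)) / N)\<^sup>2" for N h x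
  define V where "V N x = 1 / real N ^ Suc m * (\<Sum>h\<in>?P N. Q N h x)" for N x
  define E where "E = B ^ 2 ^ Suc m"
  have Q: "hk_energy 0 (cube_product T (Suc m) f h) \<le> integral\<^sup>L M (Q N h)"
    "integrable M (Q N h)" "AE x in M. Q N h x \<le> E\<^sup>2" if "N > 0" for N h
    using hk_energy_0_le_mean_square[OF ae_bounded_cube_product[OF B] that, of "Suc m" h]
    unfolding Q_def[abs_def] E_def by auto
  \<comment> \<open>For \<open>N = 0\<close> the quotient is 0 by convention, so integrability and
    the bound hold for every \<open>N\<close>, as dominated convergence asks.\<close>
  have Q0: "Q N h = (\<lambda>x. 0)" if "N = 0" for N h using that by (simp add: Q_def fun_eq_iff)
  have iQ: "integrable M (Q N h)" and bQ: "AE x in M. Q N h x \<le> E\<^sup>2" for N h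
    using Q(2,3)[of N h] Q0[of N h] by (cases "N = 0"; simp)+
  have V_le: "V N x \<le> 2 * D\<^sup>2 * cube_wiener_wintner T m f N x"
    if x: "\<forall>n. cmod (f ((T ^^ n) x)) \<le> B" and N: "N > 0" for N x
  proof -
    let ?u = "\<lambda>g n. cube_product T m f g ((T ^^ n) x)"
    have T: "(T ^^ l) ((T ^^ n) x) = (T ^^ (n + l)) x" for n l
      by (subst add.commute) (simp add: funpow_add)
    \<comment> \<open>The last coordinate \<open>l\<close> turns the larger cube product into a
      product of two values at distance \<open>l\<close>, and its Birkhoff sum into a
      correlation.\<close>
    have "V N x = 1 / real N ^ Suc m * (\<Sum>l=1..N. \<Sum>g\<in>{1..m} \<rightarrow>\<^sub>E {1..N}.
        (cmod (\<Sum>n=1..N. ?u g n * cnj (?u g (n + l))) / N)\<^sup>2)"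
      unfolding V_def Q_def sum_PiE_Suc cube_product_upd T ..
    also have "\<dots> = 1 / real N ^ m * (\<Sum>g\<in>{1..m} \<rightarrow>\<^sub>E {1..N}.
        1 / real N * (\<Sum>l=1..N. (cmod (\<Sum>n=1..N. ?u g n * cnj (?u g (n + l))) / N)\<^sup>2))"
      by (subst sum.swap) (simp add: sum_distrib_left[symmetric] sum_divide_distrib[symmetric])
    also have "\<dots> \<le> 1 / real N ^ m * (\<Sum>g\<in>{1..m} \<rightarrow>\<^sub>E {1..N}. 2 * D\<^sup>2 * sup_exponential_average (?u g) N)"
      unfolding D_def using x N
      by (intro mult_left_mono sum_mono mean_correlation_square_le cmod_cube_product_orbit_le) auto
    also have "\<dots> = 2 * D\<^sup>2 * cube_wiener_wintner T m f N x"
      unfolding cube_wiener_wintner_def by (simp add: sum_distrib_left[symmetric])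
    finally show ?thesis .
  qed
  have V0: "0 \<le> V N x" for N x
    unfolding V_def Q_def by (intro mult_nonneg_nonneg sum_nonneg) auto
  have iV: "integrable M (V N)" for N unfolding V_def[abs_def] using iQ by simp
  have "(\<lambda>N. integral\<^sup>L M (V N)) \<longlonglongrightarrow> (LINT x|M. 0)"
  proof (rule integral_dominated_convergence[where w = "\<lambda>_. E\<^sup>2"])
    show "AE x in M. (\<lambda>N. V N x) \<longlonglongrightarrow> 0"
      using lim AE_ae_bounded_orbit[OF B]
    proof eventually_elim
      case (elim x)
      have "(\<lambda>N. 2 * D\<^sup>2 * cube_wiener_wintner T m f N x) \<longlonglongrightarrow> 2 * D\<^sup>2 * 0"
        by (intro tendsto_intros elim(1))
      then have "(\<lambda>N. 2 * D\<^sup>2 * cube_wiener_wintner T m f N x) \<longlonglongrightarrow> 0" by simp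
      moreover have "eventually (\<lambda>N. norm (V N x) \<le> 2 * D\<^sup>2 * cube_wiener_wintner T m f N x) sequentially"
        using eventually_gt_at_top[of 0]
      proof eventually_elim
        case (elim N)
        show ?case
          using V_le[OF \<open>\<forall>n. cmod (f ((T ^^ n) x)) \<le> B\<close> elim] V0[of N x] by (simp only: real_norm_def abs_of_nonneg)
      qed
      ultimately show ?case by (rule Lim_null_comparison[rotated])
    qed
    show "AE x in M. norm (V N x) \<le> E\<^sup>2" for N
    proof -
      have "AE x in M. \<forall>h\<in>?P N. Q N h x \<le> E\<^sup>2"
        using bQ by (intro AE_finite_allI) (auto intro: finite_PiE)
      then show ?thesis
      proof eventually_elim
        case (elim x)
        then have "(\<Sum>h\<in>?P N. Q N h x) \<le> (\<Sum>h\<in>?P N. E\<^sup>2)" by (intro sum_mono) auto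
        also have "\<dots> = real N ^ Suc m * E\<^sup>2" by (simp add: card_PiE)
        finally have "V N x \<le> E\<^sup>2"
          unfolding V_def by (cases "N = 0") (simp_all add: field_simps)
        then show ?case using V0 by simp
      qed
    qed
  qed (use iV in auto)
  then have V_lim: "(\<lambda>N. integral\<^sup>L M (V N)) \<longlonglongrightarrow> 0" by simp
  \<comment> \<open>The base level is n = 0, where the energy is the squared modulus of the
    integral, and all m + 1 differences are averaged simultaneously.\<close>
  obtain K where K: "\<And>N. N > 0 \<Longrightarrow> hk_energy (0 + Suc m) f / 2 ^ Suc m
      \<le> 1 / real N ^ Suc m * (\<Sum>h\<in>?P N. hk_energy 0 (cube_product T (Suc m) f h)) + K / N"
    using hk_energy_le_cube_average[of B 0 "Suc m"] B by blast
  have le: "hk_energy (Suc m) f / 2 ^ Suc m \<le> integral\<^sup>L M (V N) + K / N" if N: "N > 0" for N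
  proof -
    have "1 / real N ^ Suc m * (\<Sum>h\<in>?P N. hk_energy 0 (cube_product T (Suc m) f h))
        \<le> 1 / real N ^ Suc m * (\<Sum>h\<in>?P N. integral\<^sup>L M (Q N h))"
      by (intro mult_left_mono sum_mono Q(1) N) simp
    also have "\<dots> = integral\<^sup>L M (V N)"
      unfolding V_def[abs_def] using iQ by simp
    finally show ?thesis using K[OF N] by simp
  qed
  have "(\<lambda>N. integral\<^sup>L M (V N) + K / real N) \<longlonglongrightarrow> 0 + 0"
    by (intro tendsto_intros V_lim lim_const_over_n)
  then have "hk_energy (Suc m) f / 2 ^ Suc m \<le> 0 + 0"
    by (rule tendsto_lowerbound) (use le in \<open>auto intro: eventually_mono[OF eventually_gt_at_top[of 0]]\<close>)
  then have "hk_energy (Suc m) f \<le> 0"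
    by (subst (asm) pos_divide_le_eq) (simp_all del: hk_energy.simps)
  with hk_energy_nonneg[OF f, of "Suc m"] show ?thesis by linarith
qed

theorem hk_energy_eq_0_iff:
  assumes "f \<in> Linfty M"
  shows "hk_energy (Suc m) f = 0 \<longleftrightarrow> (AE x in M. (\<lambda>N. cube_wiener_wintner T m f N x) \<longlonglongrightarrow> 0)"
  using cube_wiener_wintner_tendsto_0[OF assms] hk_energy_eq_0_if_cube_wiener_wintner[OF assms] by blast

lemma integrable_cmod_square:
  assumes "f \<in> Linfty M"
  shows "integrable M (\<lambda>x. (cmod (f x))\<^sup>2)"
proof -
  have "integrable M (\<lambda>x. f x * cnj (f x))"
    by (intro integrable_Linfty Linfty_mult Linfty_cnj assms)
  then have "integrable M (\<lambda>x. cmod (f x * cnj (f x)))" by (rule integrable_norm)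
  then show ?thesis by (simp add: norm_mult power2_eq_square)
qed

end

theorem theorem6p4:
  fixes M :: "'a measure" and T :: "'a \<Rightarrow> 'a" and Z :: "'a measure"
    and k :: nat and f :: "'a \<Rightarrow> complex"
  assumes "invertible_ergodic_system M T"
    and "k \<ge> 2"
    and "is_HKZ_factor M T k Z"
    and "f \<in> Linfty M"
  shows "f \<in> L2_perp M Z \<longleftrightarrow>
    (AE x in M.
      (\<lambda>N. (1 / real N ^ (k - 1)) *
        (\<Sum>h \<in> {1..k - 1} \<rightarrow>\<^sub>E {1..N}.
          (SUP t::real.
            (cmod ((1 / of_nat N) *
              (\<Sum>n = 1..N. exp (2 * of_real pi * \<i> * of_nat n * of_real t) *
                 cube_product T (k - 1) f h ((T ^^ n) x))))\<^sup>2)))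
      \<longlonglongrightarrow> 0)"
proof -
  interpret invertible_ergodic_system M T by (rule assms(1))
  obtain m where m: "k = Suc m" "m > 0" using assms(2) by (cases k) auto
  have "f \<in> L2_perp M Z \<longleftrightarrow> (AE x in M. complex_cond_exp M Z f x = 0)"
    using assms(4) integrable_cmod_square[OF assms(4)] by (simp add: L2_perp_def Linfty_def)
  \<comment> \<open>The factor of order \<open>k\<close> is characterized by the seminorm of order k
    + 1 = m + 2, which corresponds to \<open>hk_energy (Suc m)\<close>.\<close>
  also have "\<dots> \<longleftrightarrow> hk_seminorm M T (Suc (Suc m)) f = 0"
    using assms(3,4) unfolding is_HKZ_factor_def m(1) by simp
  also have "\<dots> \<longleftrightarrow> hk_energy (Suc m) f = 0"
    by (rule hk_seminorm_eq_0_iff[OF assms(4)])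
  also have "\<dots> \<longleftrightarrow> (AE x in M. (\<lambda>N. cube_wiener_wintner T m f N x) \<longlonglongrightarrow> 0)"
    by (rule hk_energy_eq_0_iff[OF assms(4)])
  finally show ?thesis
    unfolding cube_wiener_wintner_def sup_exponential_average_def m(1) by simp
qed

end
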